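(* Let $\mathbb{K}$ be an arbitrary algebraically closed field and let $f:\mathbb{K}^n\to\mathbb{K}^n$ be a non-special polynomial automorphism. Let $H\subset\mathbb{K}^n$ be a hypersurface that is contained in the set $\mathrm{Fix}(f)$ of fixed points of $f$. Then: 1) $H$ is smooth and irreducible. 2) $H=\mathrm{Fix}(f)$.
   Context: A polynomial automorphism of $\mathbb{K}^n$ is a polynomial map $f=(f_1,\dots,f_n):\mathbb{K}^n\to\mathbb{K}^n$ having a polynomial inverse. Its Jacobian $\mathrm{Jac}(f)=\det(\partial f_i/\partial x_j)$ is then a nonzero constant in $\mathbb{K}^*$. The automorphism $f$ is called special if $\mathrm{Jac}(f)=1$, and non-special if $\mathrm{Jac}(f)\neq 1$. $\mathrm{Fix}(f)=\{x\in\mathbb{K}^n: f(x)=x\}$. A hypersurface in $\mathbb{K}^n$ is a nonempty (Zariski) closed algebraic subset all of whose irreducible components have dimension $n-1$, regarded as a reduced variety; it is not assumed irreducible. *)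

theory Defs
  imports
    "HOL-Analysis.Analysis"
    "HOL-Library.Poly_Mapping"
    "HOL-Computational_Algebra.Polynomial"
begin

text \<open>
  Polynomials in the indeterminates $x_i$, $i$ ranging over the finite type \<open>'n\<close>: finitely
  supported coefficient families on exponent vectors. The ring operations are those of
  \<^theory>\<open>HOL-Library.Poly_Mapping\<close>; affine \<open>n\<close>-space is \<open>'k ^ 'n\<close> with \<open>n = CARD('n)\<close>.
\<close>

type_synonym ('k, 'n) mpoly = "('n \<Rightarrow>\<^sub>0 nat) \<Rightarrow>\<^sub>0 'k"

definition eval_mpoly :: "('k::comm_semiring_1, 'n::finite) mpoly \<Rightarrow> 'k ^ 'n \<Rightarrow> 'k" where
  "eval_mpoly P x =
     (\<Sum>m\<in>Poly_Mapping.keys P. Poly_Mapping.lookup P m * (\<Prod>i\<in>UNIV. x $ i ^ Poly_Mapping.lookup m i))"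

text \<open>
  The subtraction of exponent vectors is truncated, but where truncation occurs the coefficient
  vanishes.
\<close>

definition partial_deriv ::
    "'n \<Rightarrow> ('k::comm_semiring_1, 'n::finite) mpoly \<Rightarrow> ('k, 'n) mpoly" where
  "partial_deriv i P =
     (\<Sum>m\<in>Poly_Mapping.keys P.
        Poly_Mapping.single (m - Poly_Mapping.single i 1)
          (of_nat (Poly_Mapping.lookup m i) * Poly_Mapping.lookup P m))"


text \<open>
  A polynomial self-map of affine space is given by its tuple of component polynomials; over an
  infinite field, in particular over an algebraically closed one, the tuple is determined by the map.
\<close>

definition poly_map :: "('k::comm_semiring_1, 'n::finite) mpoly ^ 'n \<Rightarrow> 'k ^ 'n \<Rightarrow> 'k ^ 'n" where
  "poly_map f x = (\<chi> i. eval_mpoly (f $ i) x)"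

definition poly_automorphism :: "('k::comm_semiring_1, 'n::finite) mpoly ^ 'n \<Rightarrow> bool" where
  "poly_automorphism f \<longleftrightarrow>
     (\<exists>g :: ('k, 'n) mpoly ^ 'n.
        (\<forall>x. poly_map g (poly_map f x) = x) \<and> (\<forall>x. poly_map f (poly_map g x) = x))"

definition Jac :: "('k::comm_ring_1, 'n::finite) mpoly ^ 'n \<Rightarrow> ('k, 'n) mpoly" where
  "Jac f = det (\<chi> i j. partial_deriv j (f $ i))"

definition special :: "('k::comm_ring_1, 'n::finite) mpoly ^ 'n \<Rightarrow> bool" where
  "special f \<longleftrightarrow> Jac f = 1"

definition Fix :: "('k::comm_semiring_1, 'n::finite) mpoly ^ 'n \<Rightarrow> ('k ^ 'n) set" where
  "Fix f = {x. poly_map f x = x}"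


definition zariski_closed :: "('k::comm_semiring_1 ^ 'n::finite) set \<Rightarrow> bool" where
  "zariski_closed X \<longleftrightarrow> (\<exists>S :: ('k, 'n) mpoly set. X = {x. \<forall>P\<in>S. eval_mpoly P x = 0})"

text \<open>Irreducibility of closed sets; the empty set is not irreducible.\<close>

definition irreducible_closed :: "('k::comm_semiring_1 ^ 'n::finite) set \<Rightarrow> bool" where
  "irreducible_closed X \<longleftrightarrow> zariski_closed X \<and> X \<noteq> {} \<and>
     (\<forall>A B. zariski_closed A \<and> zariski_closed B \<and> X = A \<union> B \<longrightarrow> X = A \<or> X = B)"

definition irreducible_components ::
    "('k::comm_semiring_1 ^ 'n::finite) set \<Rightarrow> ('k ^ 'n) set set" where
  "irreducible_components X =
     {Z. irreducible_closed Z \<and> Z \<subseteq> X \<and>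
         (\<forall>Z'. irreducible_closed Z' \<and> Z \<subseteq> Z' \<and> Z' \<subseteq> X \<longrightarrow> Z' = Z)}"

text \<open>
  Krull dimension of a closed set: the supremum of the lengths $d$ of chains
  $Z_0 \subset Z_1 \subset \dots \subset Z_d$ of irreducible closed subsets.
\<close>

definition krull_dim :: "('k::comm_semiring_1 ^ 'n::finite) set \<Rightarrow> enat" where
  "krull_dim X =
     Sup {enat d | d. \<exists>Z :: nat \<Rightarrow> ('k ^ 'n) set.
            (\<forall>i\<le>d. irreducible_closed (Z i) \<and> Z i \<subseteq> X) \<and> (\<forall>i<d. Z i \<subset> Z (Suc i))}"

definition hypersurface :: "('k::comm_semiring_1 ^ 'n::finite) set \<Rightarrow> bool" where
  "hypersurface H \<longleftrightarrow> zariski_closed H \<and> H \<noteq> {} \<and>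
     (\<forall>Z\<in>irreducible_components H. krull_dim Z = enat (CARD('n) - 1))"


text \<open>
  Smoothness of a closed set as a reduced variety. The Zariski tangent space is cut out by the
  differentials of all polynomials in the (radical) vanishing ideal; a point is smooth if the
  dimension of the tangent space is the local dimension, i.e. the largest dimension of an
  irreducible component through the point.
\<close>

definition vanishing_ideal :: "('k::comm_semiring_1 ^ 'n::finite) set \<Rightarrow> ('k, 'n) mpoly set" where
  "vanishing_ideal X = {P. \<forall>x\<in>X. eval_mpoly P x = 0}"

definition tangent_space ::
    "('k::comm_semiring_1 ^ 'n::finite) set \<Rightarrow> 'k ^ 'n \<Rightarrow> ('k ^ 'n) set" where
  "tangent_space X p =
     {v. \<forall>P\<in>vanishing_ideal X. (\<Sum>i\<in>UNIV. eval_mpoly (partial_deriv i P) p * v $ i) = 0}"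

definition local_dim :: "('k::comm_semiring_1 ^ 'n::finite) set \<Rightarrow> 'k ^ 'n \<Rightarrow> enat" where
  "local_dim X p = Sup (krull_dim ` {Z \<in> irreducible_components X. p \<in> Z})"

definition smooth :: "('k::field ^ 'n::finite) set \<Rightarrow> bool" where
  "smooth X \<longleftrightarrow> (\<forall>p\<in>X. enat (vec.dim (tangent_space X p)) = local_dim X p)"

end

theory Submission
  imports Defs
begin

text \<open>
  Let $Z$ be an irreducible component of $H$. The polynomial ring is factorial and $Z$ has dimension
  $n - 1$, so the vanishing ideal of $Z$ is generated by a single polynomial $h$
  (\<open>vanishing_ideal_principal\<close>). As $f$ fixes $Z$ pointwise, $f_i = x_i + h a_i$ with polynomials
  $a_i$, so on $Z$ the Jacobian matrix is the identity plus the rank one matrix $(a_i \partial_j h)$.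
  The Jacobian of $f$ is a constant $c$, hence $1 + \sum_i a_i \partial_i h = c$ on $Z$. Because
  $c \neq 1$, the gradient of $h$ vanishes nowhere on $Z$, which makes $Z$ smooth.

  Both $f$ and its inverse fix $Z$, so $h$ divides $h \circ f$ and $h \circ f^{-1}$; therefore
  $h \circ f = u h$ with $u$ a unit, i.e. a constant. Differentiating at a point of $Z$ gives
  $u = c$. At a fixed point $x$ of $f$ this reads $h(x) = c\, h(x)$, so $h(x) = 0$ and $x \in Z$:
  the single component $Z$ already contains \<open>Fix f\<close> (\<open>fixed_hypersurface\<close>). From
  $\mathrm{Fix}(f) \subseteq Z \subseteq H \subseteq \mathrm{Fix}(f)$ all three sets agree, and the
  irreducibility of $H$ comes for free.

  The commutative algebra behind \<open>vanishing_ideal_principal\<close> has two parts. An element $h$ of least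
  degree in the vanishing ideal is irreducible, hence prime by Gauss's lemma
  (\<open>irreducible_imp_prime_elem_mpoly\<close>). If $(h)$ were not the whole ideal, the prime ideals $0$ and
  $(h)$ would prolong the chain of vanishing ideals that witnesses $\dim Z = n - 1$ to a chain with
  $n + 1$ strict inclusions, and there is none in $n$ variables (\<open>no_long_prime_chain\<close>).
\<close>

section \<open>Substitution into multivariate polynomials\<close>

definition Const :: "'k::comm_ring_1 \<Rightarrow> ('k, 'n::finite) mpoly" where
  "Const c = Poly_Mapping.single 0 c"

definition Var :: "'n \<Rightarrow> ('k::comm_ring_1, 'n::finite) mpoly" where
  "Var i = Poly_Mapping.single (Poly_Mapping.single i 1) 1"

text \<open>
  Evaluation at a point, composition with a polynomial map and passage to polynomials in one
  distinguished variable are all of this form: coefficients are sent along a ring homomorphism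
  \<open>\<kappa>\<close> and the indeterminates to arbitrary ring elements.
\<close>

definition subst ::
    "('k::comm_ring_1 \<Rightarrow> 'a::comm_ring_1) \<Rightarrow> ('n \<Rightarrow> 'a) \<Rightarrow> ('k, 'n::finite) mpoly \<Rightarrow> 'a" where
  "subst \<kappa> x P =
     (\<Sum>m\<in>Poly_Mapping.keys P. \<kappa> (Poly_Mapping.lookup P m) * (\<Prod>i\<in>UNIV. x i ^ Poly_Mapping.lookup m i))"

lemma sum_single_keys:
  "P = (\<Sum>m\<in>Poly_Mapping.keys P. Poly_Mapping.single m (Poly_Mapping.lookup P m))"
proof (rule poly_mapping_eqI)
  fix k
  show "Poly_Mapping.lookup P k =
    Poly_Mapping.lookup (\<Sum>m\<in>Poly_Mapping.keys P. Poly_Mapping.single m (Poly_Mapping.lookup P m)) k"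
    by (simp add: lookup_sum lookup_single when_def in_keys_iff sum.delta)
qed

lemma Const_add: "Const (a + b) = Const a + Const b"
  and Const_mult: "Const (a * b) = Const a * Const b"
  and Const_0 [simp]: "Const 0 = 0"
  and Const_1 [simp]: "Const 1 = 1"
  by (simp_all add: Const_def single_add mult_single)

lemma Const_uminus: "Const (- a) = - Const a"
  by (simp add: Const_def single_uminus)

lemma Const_eq_iff [simp]: "Const a = Const b \<longleftrightarrow> a = b"
  unfolding Const_def by (metis lookup_single_eq)

lemma Const_eq_0_iff [simp]: "Const a = 0 \<longleftrightarrow> a = 0"
  using Const_eq_iff[of a 0] by (simp del: Const_eq_iff)

lemma Var_power: "Var i ^ n = Poly_Mapping.single (Poly_Mapping.single i n) 1"
  by (induction n) (simp_all add: Var_def mult_single single_add[symmetric])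

lemma prod_single_one:
  assumes "finite A"
  shows "(\<Prod>i\<in>A. Poly_Mapping.single (m i) (1::'k::comm_ring_1))
    = Poly_Mapping.single (\<Sum>i\<in>A. m i) 1"
  using assms by (induction A rule: finite_induct) (simp_all add: mult_single)

lemma single_eq_Const_mult_Vars:
  "Poly_Mapping.single m c = Const c * (\<Prod>i\<in>UNIV. Var i ^ Poly_Mapping.lookup m i)"
proof -
  have "(\<Sum>i\<in>UNIV. Poly_Mapping.single i (Poly_Mapping.lookup m i)) = m"
    by (rule poly_mapping_eqI) (simp add: lookup_sum lookup_single when_def sum.delta)
  then show ?thesis
    by (simp add: Var_power prod_single_one mult_single Const_def)
qed

lemma mpoly_induct [case_names Const Var add mult]:
  assumes "\<And>c. Q (Const c)" "\<And>i. Q (Var i)"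
    and add: "\<And>P R. Q P \<Longrightarrow> Q R \<Longrightarrow> Q (P + R)"
    and mult: "\<And>P R. Q P \<Longrightarrow> Q R \<Longrightarrow> Q (P * R)"
  shows "Q P"
proof -
  have pow: "Q (Var i ^ n)" for i n
    by (induction n) (use assms(1)[of 1] assms(2) mult in auto)
  have prod: "finite A \<Longrightarrow> Q (\<Prod>i\<in>A. Var i ^ f i)" for A f
    by (induction A rule: finite_induct) (use assms(1)[of 1] pow mult in auto)
  have single: "Q (Poly_Mapping.single m c)" for m c
    unfolding single_eq_Const_mult_Vars by (intro mult assms(1) prod) simp
  have "finite A \<Longrightarrow> Q (\<Sum>m\<in>A. Poly_Mapping.single m (f m))" for A f
    by (induction A rule: finite_induct) (use assms(1)[of 0] single add in auto)
  then show ?thesis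
    by (subst sum_single_keys) simp
qed

locale coeff_hom =
  fixes \<kappa> :: "'k::comm_ring_1 \<Rightarrow> 'a::comm_ring_1"
  assumes hom_add: "\<kappa> (a + b) = \<kappa> a + \<kappa> b"
    and hom_mult: "\<kappa> (a * b) = \<kappa> a * \<kappa> b"
    and hom_1: "\<kappa> 1 = 1"
begin

lemma hom_0: "\<kappa> 0 = 0"
  using hom_add[of 0 0] by simp

lemma subst_superset:
  assumes "finite S" "Poly_Mapping.keys P \<subseteq> S"
  shows "subst \<kappa> x P =
    (\<Sum>m\<in>S. \<kappa> (Poly_Mapping.lookup P m) * (\<Prod>i\<in>UNIV. x i ^ Poly_Mapping.lookup m i))"
  unfolding subst_def
  by (rule sum.mono_neutral_left) (use assms in \<open>auto simp: in_keys_iff hom_0\<close>)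

lemma subst_add: "subst \<kappa> x (P + Q) = subst \<kappa> x P + subst \<kappa> x Q"
proof -
  let ?S = "Poly_Mapping.keys P \<union> Poly_Mapping.keys Q"
  have "Poly_Mapping.keys (P + Q) \<subseteq> ?S"
    by (rule keys_add)
  then show ?thesis
    by (simp add: subst_superset[of ?S] lookup_add hom_add sum.distrib[symmetric] algebra_simps)
qed

lemma subst_0 [simp]: "subst \<kappa> x 0 = 0"
  by (simp add: subst_def)

lemma subst_single:
  "subst \<kappa> x (Poly_Mapping.single m c) = \<kappa> c * (\<Prod>i\<in>UNIV. x i ^ Poly_Mapping.lookup m i)"
  by (subst subst_superset[of "{m}"]) auto

lemma subst_Const [simp]: "subst \<kappa> x (Const c) = \<kappa> c"
  by (simp add: Const_def subst_single)

lemma subst_1 [simp]: "subst \<kappa> x 1 = 1"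
  using subst_Const[of x 1] by (simp add: hom_1)

lemma subst_Var [simp]: "subst \<kappa> x (Var i) = x i"
proof -
  have "(\<Prod>j\<in>UNIV. x j ^ Poly_Mapping.lookup (Poly_Mapping.single i 1) j)
     = (\<Prod>j\<in>UNIV. if i = j then x j else 1)"
    by (rule prod.cong) (auto simp: lookup_single when_def)
  then show ?thesis
    by (simp add: Var_def subst_single hom_1)
qed

lemma subst_sum: "subst \<kappa> x (\<Sum>a\<in>A. f a) = (\<Sum>a\<in>A. subst \<kappa> x (f a))"
  by (induction A rule: infinite_finite_induct) (simp_all add: subst_add)

lemma subst_mult: "subst \<kappa> x (P * Q) = subst \<kappa> x P * subst \<kappa> x Q"
proof -
  have "subst \<kappa> x ((\<Sum>m\<in>A. Poly_Mapping.single m (f m)) * (\<Sum>n\<in>B. Poly_Mapping.single n (g n)))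
      = (\<Sum>m\<in>A. subst \<kappa> x (Poly_Mapping.single m (f m))) *
        (\<Sum>n\<in>B. subst \<kappa> x (Poly_Mapping.single n (g n)))" for A B f g
    by (simp add: sum_product subst_sum mult_single subst_single hom_mult lookup_add power_add
        prod.distrib mult_ac)
  from this[where A = "Poly_Mapping.keys P" and f = "Poly_Mapping.lookup P"
      and B = "Poly_Mapping.keys Q" and g = "Poly_Mapping.lookup Q"]
  show ?thesis
    by (simp add: sum_single_keys[symmetric] subst_sum[symmetric])
qed

lemma subst_uminus: "subst \<kappa> x (- P) = - subst \<kappa> x P"
  using subst_add[of x P "- P"] by (simp add: eq_neg_iff_add_eq_0 add.commute)

lemma subst_diff: "subst \<kappa> x (P - Q) = subst \<kappa> x P - subst \<kappa> x Q"
  using subst_add[of x P "- Q"] by (simp add: subst_uminus)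

lemma subst_power: "subst \<kappa> x (P ^ n) = subst \<kappa> x P ^ n"
  by (induction n) (simp_all add: subst_mult)

lemma subst_prod: "subst \<kappa> x (\<Prod>a\<in>A. f a) = (\<Prod>a\<in>A. subst \<kappa> x (f a))"
  by (induction A rule: infinite_finite_induct) (simp_all add: subst_mult)

end

interpretation point: coeff_hom "\<lambda>c::'k::comm_ring_1. c"
  by standard simp_all

interpretation comp: coeff_hom "Const :: 'k \<Rightarrow> ('k::comm_ring_1, 'n::finite) mpoly"
  by standard (simp_all add: Const_add Const_mult)

lemma eval_eq_subst: "eval_mpoly P x = subst (\<lambda>c. c) (\<lambda>i. x $ i) P"
  by (simp add: eval_mpoly_def subst_def)

lemma eval_add [simp]: "eval_mpoly (P + Q) x = eval_mpoly P x + eval_mpoly Q x"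
  and eval_mult [simp]: "eval_mpoly (P * Q) x = eval_mpoly P x * eval_mpoly Q x"
  and eval_diff [simp]: "eval_mpoly (P - Q) x = eval_mpoly P x - eval_mpoly Q x"
  and eval_uminus [simp]: "eval_mpoly (- P) x = - eval_mpoly P x"
  and eval_0 [simp]: "eval_mpoly 0 x = 0"
  and eval_1 [simp]: "eval_mpoly 1 x = 1"
  and eval_Const [simp]: "eval_mpoly (Const c) x = c"
  and eval_Var [simp]: "eval_mpoly (Var i) x = x $ i"
  and eval_power [simp]: "eval_mpoly (P ^ n) x = eval_mpoly P x ^ n"
  and eval_sum: "eval_mpoly (\<Sum>a\<in>A. F a) x = (\<Sum>a\<in>A. eval_mpoly (F a) x)"
  and eval_prod: "eval_mpoly (\<Prod>a\<in>A. F a) x = (\<Prod>a\<in>A. eval_mpoly (F a) x)"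
  for x :: "'k::comm_ring_1 ^ 'n::finite"
  by (simp_all add: eval_eq_subst point.subst_add point.subst_mult point.subst_diff
      point.subst_uminus point.subst_power point.subst_sum point.subst_prod)

definition compose_mpoly :: "('k::comm_ring_1, 'n::finite) mpoly ^ 'n \<Rightarrow> ('k, 'n) mpoly \<Rightarrow> ('k, 'n) mpoly" where
  "compose_mpoly f P = subst Const (\<lambda>i. f $ i) P"

lemma eval_compose_mpoly: "eval_mpoly (compose_mpoly f P) x = eval_mpoly P (poly_map f x)"
proof -
  have "eval_mpoly (subst Const (\<lambda>i. f $ i) P) x = eval_mpoly P (poly_map f x)"
    by (induction P rule: mpoly_induct) (simp_all add: comp.subst_add comp.subst_mult poly_map_def)
  then show ?thesis
    by (simp add: compose_mpoly_def)
qed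

section \<open>Polynomials in one distinguished variable\<close>

text \<open>
  The subring of polynomials in the indeterminates \<open>x\<^sub>i\<close>, \<open>i \<in> V\<close>. It allows inductions on the
  number of variables although the set of all variables is a type.
\<close>

definition in_vars :: "'n set \<Rightarrow> ('k::comm_ring_1, 'n::finite) mpoly set" where
  "in_vars V = {P. \<forall>m\<in>Poly_Mapping.keys P. \<forall>i. Poly_Mapping.lookup m i \<noteq> 0 \<longrightarrow> i \<in> V}"

text \<open>
  A multivariate polynomial read as a polynomial in \<open>x\<^sub>i\<close>; its coefficients live in the same ring, but
  do not involve \<open>x\<^sub>i\<close>. Plugging \<open>x\<^sub>i\<close> back in recovers the polynomial (\<open>poly_univ\<close>).
\<close>

definition univariate :: "'n \<Rightarrow> ('k::comm_ring_1, 'n::finite) mpoly \<Rightarrow> ('k, 'n) mpoly poly" where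
  "univariate i P = subst (\<lambda>c. [:Const c:]) (\<lambda>j. if j = i then [:0, 1:] else [:Var j:]) P"

interpretation univariate: coeff_hom "\<lambda>c. [:Const c :: ('k::comm_ring_1, 'n::finite) mpoly:]"
  by standard (simp_all add: Const_add Const_mult one_pCons)

lemma univ_add: "univariate i (P + Q) = univariate i P + univariate i Q"
  and univ_mult: "univariate i (P * Q) = univariate i P * univariate i Q"
  and univ_diff: "univariate i (P - Q) = univariate i P - univariate i Q"
  and univ_0 [simp]: "univariate i 0 = 0"
  and univ_1 [simp]: "univariate i 1 = 1"
  and univ_Const [simp]: "univariate i (Const c) = [:Const c:]"
  and univ_Var: "univariate i (Var j) = (if j = i then [:0, 1:] else [:Var j:])"
  and univ_power: "univariate i (P ^ n) = univariate i P ^ n"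
  and univ_sum: "univariate i (\<Sum>a\<in>A. F a) = (\<Sum>a\<in>A. univariate i (F a))"
  by (simp_all add: univariate_def univariate.subst_add univariate.subst_mult univariate.subst_diff
      univariate.subst_power univariate.subst_sum)

lemma poly_univ [simp]: "poly (univariate i P) (Var i) = P"
  by (induction P rule: mpoly_induct) (simp_all add: univ_add univ_mult univ_Var)

lemma univ_eq_0_iff [simp]: "univariate i P = 0 \<longleftrightarrow> P = 0"
  by (metis poly_univ poly_0 univ_0)

lemma in_vars_0 [simp]: "0 \<in> in_vars V"
  and in_vars_Const [simp]: "Const c \<in> in_vars V"
  and in_vars_1 [simp]: "1 \<in> in_vars V"
  by (auto simp: in_vars_def Const_def)

lemma in_vars_Var: "j \<in> V \<Longrightarrow> Var j \<in> in_vars V"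
  by (auto simp: in_vars_def Var_def lookup_single when_def)

lemma in_vars_add [intro]: "P \<in> in_vars V \<Longrightarrow> Q \<in> in_vars V \<Longrightarrow> P + Q \<in> in_vars V"
  using keys_add[of P Q] by (auto simp: in_vars_def)

lemma in_vars_uminus: "P \<in> in_vars V \<Longrightarrow> - P \<in> in_vars V"
  by (auto simp: in_vars_def in_keys_iff)

lemma in_vars_diff [intro]: "P \<in> in_vars V \<Longrightarrow> Q \<in> in_vars V \<Longrightarrow> P - Q \<in> in_vars V"
  using in_vars_add[of P V "- Q"] in_vars_uminus by auto

lemma in_vars_mult [intro]: "P \<in> in_vars V \<Longrightarrow> Q \<in> in_vars V \<Longrightarrow> P * Q \<in> in_vars V"
  using keys_mult[of P Q] by (fastforce simp: in_vars_def lookup_add)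

lemma in_vars_power: "P \<in> in_vars V \<Longrightarrow> P ^ n \<in> in_vars V"
  by (induction n) auto

lemma in_vars_sum: "(\<And>a. a \<in> A \<Longrightarrow> F a \<in> in_vars V) \<Longrightarrow> (\<Sum>a\<in>A. F a) \<in> in_vars V"
  by (induction A rule: infinite_finite_induct) auto

lemma in_vars_UNIV [simp]: "P \<in> in_vars UNIV"
  by (simp add: in_vars_def)

lemma in_vars_mono: "V \<subseteq> W \<Longrightarrow> P \<in> in_vars V \<Longrightarrow> P \<in> in_vars W"
  by (auto simp: in_vars_def)

lemma in_vars_empty: "P \<in> in_vars {} \<longleftrightarrow> (\<exists>c. P = Const c)"
proof
  assume "P \<in> in_vars {}"
  then have "Poly_Mapping.keys P \<subseteq> {0}"
    by (auto simp: in_vars_def intro!: poly_mapping_eqI)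
  then have "(\<Sum>m\<in>Poly_Mapping.keys P. Poly_Mapping.single m (Poly_Mapping.lookup P m))
      = (\<Sum>m\<in>{0}. Poly_Mapping.single m (Poly_Mapping.lookup P m))"
    by (intro sum.mono_neutral_left) (auto simp: in_keys_iff)
  then have "P = Const (Poly_Mapping.lookup P 0)"
    by (simp add: sum_single_keys[symmetric] Const_def)
  then show "\<exists>c. P = Const c" ..
qed auto

lemma in_vars_induct [consumes 1, case_names Const Var add mult]:
  assumes "P \<in> in_vars V" and "\<And>c. Q (Const c)" "\<And>i. i \<in> V \<Longrightarrow> Q (Var i)"
    and add: "\<And>P R. Q P \<Longrightarrow> Q R \<Longrightarrow> Q (P + R)"
    and mult: "\<And>P R. Q P \<Longrightarrow> Q R \<Longrightarrow> Q (P * R)"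
  shows "Q P"
proof -
  have pow: "Q (Var i ^ n)" if "n \<noteq> 0 \<Longrightarrow> i \<in> V" for i n
  proof (cases "n = 0")
    case False
    then have "Q (Var i ^ Suc k)" for k
      using that assms(3)[of i] mult by (induction k) auto
    with False show ?thesis by (cases n) auto
  qed (use assms(2)[of 1] in simp)
  have prod: "finite A \<Longrightarrow> (\<And>i. f i \<noteq> 0 \<Longrightarrow> i \<in> V) \<Longrightarrow> Q (\<Prod>i\<in>A. Var i ^ f i)" for A f
    by (induction A rule: finite_induct) (use assms(2)[of 1] pow mult in auto)
  have single: "Q (Poly_Mapping.single m c)" if "\<And>i. Poly_Mapping.lookup m i \<noteq> 0 \<Longrightarrow> i \<in> V" for m c
    unfolding single_eq_Const_mult_Vars by (intro mult assms(2) prod that) simp_all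
  have "finite A \<Longrightarrow> (\<And>m i. m \<in> A \<Longrightarrow> Poly_Mapping.lookup m i \<noteq> 0 \<Longrightarrow> i \<in> V) \<Longrightarrow>
      Q (\<Sum>m\<in>A. Poly_Mapping.single m (f m))" for A f
    by (induction A rule: finite_induct) (use assms(2)[of 0] single add in \<open>auto intro!: add single\<close>)
  from this[of "Poly_Mapping.keys P" "Poly_Mapping.lookup P"] show ?thesis
    using assms(1) by (subst sum_single_keys) (auto simp: in_vars_def)
qed

lemma univ_const:
  assumes "P \<in> in_vars V" "i \<notin> V"
  shows "univariate i P = [:P:]"
  using assms(1)
  by (induction rule: in_vars_induct) (use assms(2) in \<open>auto simp: univ_add univ_mult univ_Var\<close>)

lemma coeff_univ_in_vars:
  assumes "P \<in> in_vars (insert i V)"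
  shows "coeff (univariate i P) n \<in> in_vars V"
  using assms
proof (induction arbitrary: n rule: in_vars_induct)
  case (mult P R)
  then show ?case by (auto simp: univ_mult coeff_mult intro!: in_vars_sum in_vars_mult)
qed (auto simp: univ_add univ_Var coeff_pCons in_vars_Var split: nat.splits)

lemma coeff_univ_in_other_vars: "coeff (univariate i P) n \<in> in_vars (- {i})"
  by (rule coeff_univ_in_vars[THEN in_vars_mono[rotated], of _ _ "- {i}"])
    (auto simp: insert_UNIV Compl_partition intro: in_vars_mono[OF _ in_vars_UNIV])

text \<open>
  The leading coefficients with respect to one variable are polynomials in fewer variables, so the
  univariate argument can be iterated.
\<close>

lemma mpoly_no_zero_divisors:
  fixes P Q :: "('k::idom, 'n::finite) mpoly"
  assumes "P * Q = 0"
  shows "P = 0 \<or> Q = 0"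
proof -
  have "finite V \<Longrightarrow> P \<in> in_vars V \<Longrightarrow> Q \<in> in_vars V \<Longrightarrow> P * Q = 0 \<Longrightarrow> P = 0 \<or> Q = 0" for V
  proof (induction V arbitrary: P Q rule: finite_induct)
    case empty
    then show ?case by (auto simp: in_vars_empty Const_mult[symmetric])
  next
    case (insert i V)
    have "univariate i P * univariate i Q = 0"
      using insert.prems(3) by (simp add: univ_mult[symmetric])
    then have "lead_coeff (univariate i P) * lead_coeff (univariate i Q) = 0"
      by (metis coeff_mult_degree_sum coeff_0)
    then have "lead_coeff (univariate i P) = 0 \<or> lead_coeff (univariate i Q) = 0"
      using insert.prems by (intro insert.IH coeff_univ_in_vars)
    then show ?case by simp
  qed
  from this[of UNIV] assms show ?thesis by simp
qed

text \<open>
  If all other coordinates are fixed, a polynomial that vanishes everywhere becomes a univariate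
  polynomial with infinitely many roots; its coefficients are polynomial functions in fewer
  variables which then vanish everywhere as well.
\<close>

lemma eval_eqI:
  fixes P Q :: "('k::idom, 'n::finite) mpoly"
  assumes inf: "infinite (UNIV :: 'k set)" and "\<And>x. eval_mpoly P x = eval_mpoly Q x"
  shows "P = Q"
proof -
  have "finite V \<Longrightarrow> P \<in> in_vars V \<Longrightarrow> (\<And>x. eval_mpoly P x = 0) \<Longrightarrow> P = 0"
    for P :: "('k, 'n) mpoly" and V
  proof (induction V arbitrary: P rule: finite_induct)
    case empty
    then show ?case by (auto simp: in_vars_empty)
  next
    case (insert i V)
    have "eval_mpoly (coeff (univariate i P) n) x = 0" for n x
    proof -
      define F where "F = (\<Sum>n\<le>degree (univariate i P). monom (eval_mpoly (coeff (univariate i P) n) x) n)"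
      have indep: "eval_mpoly q (\<chi> j. if j = i then t else x $ j) = eval_mpoly q x"
        if "q \<in> in_vars V" for q and t :: 'k
        using that by (induction rule: in_vars_induct) (use insert.hyps in auto)
      have "poly F t = 0" for t
      proof -
        have "eval_mpoly (poly (univariate i P) (Var i)) (\<chi> j. if j = i then t else x $ j)
            = (\<Sum>n\<le>degree (univariate i P). eval_mpoly (coeff (univariate i P) n) x * t ^ n)"
          using insert.prems(1) by (simp add: poly_altdef eval_sum indep coeff_univ_in_vars)
        also have "\<dots> = poly F t"
          by (simp add: F_def poly_sum poly_monom)
        finally show ?thesis using insert.prems(2) by simp
      qed
      then have "F = 0"
        using inf poly_roots_finite[of F] by auto
      moreover have "coeff F n = eval_mpoly (coeff (univariate i P) n) x"
        by (simp add: F_def coeff_sum sum.delta coeff_eq_0)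
      ultimately show ?thesis by simp
    qed
    then have "coeff (univariate i P) n = 0" for n
      using insert by (intro insert.IH coeff_univ_in_vars) auto
    then show ?case
      by (metis leading_coeff_0_iff univ_eq_0_iff)
  qed
  from this[of UNIV "P - Q"] assms(2) show ?thesis by simp
qed

text \<open>
  Over a finite field, $1 + \prod_a (x - a)$ has no root.
\<close>

lemma infinite_UNIV_alg_closed: "infinite (UNIV :: 'k::alg_closed_field set)"
proof
  assume fin: "finite (UNIV :: 'k set)"
  define p :: "'k poly" where "p = (\<Prod>a\<in>UNIV. [:- a, 1:])"
  have "degree p = card (UNIV :: 'k set)"
    unfolding p_def by (subst degree_prod_eq_sum_degree) auto
  then have "degree p > 0"
    using fin by (simp add: card_gt_0_iff)
  then have "degree (p + 1) > 0"
    by (subst degree_add_eq_left) auto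
  then obtain x where "poly (p + 1) x = 0"
    using alg_closed_imp_poly_has_root by blast
  moreover have "poly p x = 0"
    unfolding p_def using fin by (simp add: poly_prod)
  ultimately show False by simp
qed

section \<open>Unique factorisation\<close>

lemma mpoly_mult_left_cancel:
  fixes P Q R :: "('k::idom, 'n::finite) mpoly"
  assumes "R \<noteq> 0" "R * P = R * Q"
  shows "P = Q"
  using mpoly_no_zero_divisors[of R "P - Q"] assms by (simp add: algebra_simps)

lemma mpoly_mult_eq_0_iff:
  fixes P Q :: "('k::idom, 'n::finite) mpoly"
  shows "P * Q = 0 \<longleftrightarrow> P = 0 \<or> Q = 0"
  using mpoly_no_zero_divisors by auto

lemma degree_univ_mult:
  fixes P Q :: "('k::idom, 'n::finite) mpoly"
  assumes "P \<noteq> 0" "Q \<noteq> 0"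
  shows "degree (univariate i (P * Q)) = degree (univariate i P) + degree (univariate i Q)"
proof (rule antisym)
  show "degree (univariate i (P * Q)) \<le> degree (univariate i P) + degree (univariate i Q)"
    by (simp add: univ_mult degree_mult_le)
  have "coeff (univariate i (P * Q)) (degree (univariate i P) + degree (univariate i Q)) \<noteq> 0"
    using assms by (simp add: univ_mult coeff_mult_degree_sum mpoly_mult_eq_0_iff)
  then show "degree (univariate i P) + degree (univariate i Q) \<le> degree (univariate i (P * Q))"
    by (rule le_degree)
qed

lemma in_vars_iff_degree: "P \<in> in_vars V \<longleftrightarrow> (\<forall>i. i \<notin> V \<longrightarrow> degree (univariate i P) = 0)"
proof
  assume *: "\<forall>i. i \<notin> V \<longrightarrow> degree (univariate i P) = 0"
  have "P \<in> in_vars (- {i})" if "i \<notin> V" for i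
  proof -
    have "univariate i P = [:coeff (univariate i P) 0:]"
      using * that by (metis degree_eq_zeroE coeff_pCons_0)
    then have "P = coeff (univariate i P) 0"
      by (metis poly_univ poly_pCons poly_0 mult_zero_right add_0_right)
    then show ?thesis
      using coeff_univ_in_other_vars[of i P 0] by simp
  qed
  then have "i \<in> V" if "m \<in> Poly_Mapping.keys P" "Poly_Mapping.lookup m i \<noteq> 0" for m i
    using that by (cases "i \<in> V") (auto simp: in_vars_def)
  then show "P \<in> in_vars V"
    by (simp add: in_vars_def)
qed (auto simp: univ_const)

lemma in_vars_factor:
  fixes P Q :: "('k::idom, 'n::finite) mpoly"
  assumes "P * Q \<in> in_vars V" "P * Q \<noteq> 0"
  shows "P \<in> in_vars V" "Q \<in> in_vars V"
  using assms by (auto simp: in_vars_iff_degree degree_univ_mult mpoly_mult_eq_0_iff)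

text \<open>
  The sum of the partial degrees is, like the total degree, additive on products and zero exactly on
  constants, but it inherits both properties directly from the univariate degrees. It serves as the
  measure for all inductions on divisors.
\<close>

definition degree_sum :: "('k::comm_ring_1, 'n::finite) mpoly \<Rightarrow> nat" where
  "degree_sum P = (\<Sum>i\<in>UNIV. degree (univariate i P))"

lemma degree_sum_mult:
  fixes P Q :: "('k::idom, 'n::finite) mpoly"
  assumes "P \<noteq> 0" "Q \<noteq> 0"
  shows "degree_sum (P * Q) = degree_sum P + degree_sum Q"
  using assms by (simp add: degree_sum_def degree_univ_mult sum.distrib)

lemma degree_sum_eq_0_iff: "degree_sum P = 0 \<longleftrightarrow> (\<exists>c. P = Const c)"
  by (simp add: degree_sum_def in_vars_empty[symmetric] in_vars_iff_degree)

lemma unit_iff_Const: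
  fixes P :: "('k::field, 'n::finite) mpoly"
  shows "P dvd 1 \<longleftrightarrow> (\<exists>c. c \<noteq> 0 \<and> P = Const c)"
proof
  assume "P dvd 1"
  then obtain Q where Q: "1 = P * Q" ..
  then have "P \<noteq> 0" "Q \<noteq> 0" by auto
  then have "degree_sum P = 0"
    using degree_sum_mult[of P Q] Q degree_sum_eq_0_iff[of "1 :: ('k, 'n) mpoly"]
    by (metis add_is_0 Const_1)
  with \<open>P \<noteq> 0\<close> show "\<exists>c. c \<noteq> 0 \<and> P = Const c"
    by (auto simp: degree_sum_eq_0_iff)
next
  assume "\<exists>c. c \<noteq> 0 \<and> P = Const c"
  then obtain c where "c \<noteq> 0" "P = Const c" by auto
  then have "1 = P * Const (inverse c)"
    by (simp add: Const_mult[symmetric])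
  then show "P dvd 1" ..
qed

lemma exists_irreducible_factor:
  fixes P :: "('k::field, 'n::finite) mpoly"
  assumes "P \<noteq> 0" "\<not> P dvd 1"
  shows "\<exists>R. irreducible R \<and> R dvd P"
  using assms
proof (induction "degree_sum P" arbitrary: P rule: less_induct)
  case less
  show ?case
  proof (cases "irreducible P")
    case False
    with less.prems obtain A B where AB: "P = A * B" "\<not> A dvd 1" "\<not> B dvd 1"
      by (auto simp: irreducible_def)
    with less.prems have "A \<noteq> 0" "B \<noteq> 0" by auto
    moreover from this AB have "degree_sum B \<noteq> 0"
      by (metis Const_0 degree_sum_eq_0_iff unit_iff_Const)
    ultimately show ?thesis
      using less.hyps[of A] AB by (auto simp: degree_sum_mult)
  qed auto
qed

lemma dvd_iff_dvd_coeffs: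
  assumes "R \<in> in_vars V" "i \<notin> V"
  shows "R dvd P \<longleftrightarrow> (\<forall>n. R dvd coeff (univariate i P) n)"
proof
  assume "R dvd P"
  then obtain Q where Q: "P = R * Q" ..
  have "univariate i P = smult R (univariate i Q)"
    using univ_const[OF assms] by (simp add: Q univ_mult)
  then show "\<forall>n. R dvd coeff (univariate i P) n"
    by simp
next
  assume "\<forall>n. R dvd coeff (univariate i P) n"
  then have "R dvd (\<Sum>n\<le>degree (univariate i P). coeff (univariate i P) n * Var i ^ n)"
    by (intro dvd_sum) auto
  then show "R dvd P"
    by (simp add: poly_altdef[symmetric])
qed

text \<open>
  The factoriality statement relative to the variables in \<open>V\<close>. Divisibility and irreducibility refer
  to the full polynomial ring: divisors of a nonzero polynomial in the variables \<open>V\<close> involve no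
  further variables (\<open>in_vars_factor\<close>), so this agrees with the notions inside the subring.
\<close>

definition irreducibles_prime :: "'k::comm_ring_1 itself \<Rightarrow> 'n::finite set \<Rightarrow> bool" where
  "irreducibles_prime _ V \<longleftrightarrow> (\<forall>R A B. irreducible R \<longrightarrow>
     R \<in> in_vars V \<longrightarrow> A \<in> in_vars V \<longrightarrow> B \<in> in_vars V \<longrightarrow>
     R dvd A * B \<longrightarrow> R dvd A \<or> R dvd (B :: ('k, 'n) mpoly))"

text \<open>
  The classical argument: if \<open>R\<close> divides neither factor, the first coefficients of \<open>A\<close> and \<open>B\<close> with
  respect to \<open>x\<^sub>i\<close> that are not divisible by \<open>R\<close> produce a coefficient of \<open>A * B\<close> that is not divisible
  by \<open>R\<close> either.
\<close>

lemma Gauss_lemma: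
  fixes R A B :: "('k::comm_ring_1, 'n::finite) mpoly"
  assumes V: "irreducibles_prime TYPE('k) V" "i \<notin> V" and R: "irreducible R" "R \<in> in_vars V"
    and A: "A \<in> in_vars (insert i V)" and B: "B \<in> in_vars (insert i V)"
    and dvd: "R dvd A * B"
  shows "R dvd A \<or> R dvd B"
proof (rule ccontr)
  assume "\<not> ?thesis"
  then have nd: "\<exists>n. \<not> R dvd coeff (univariate i A) n" "\<exists>n. \<not> R dvd coeff (univariate i B) n"
    using dvd_iff_dvd_coeffs[OF R(2) V(2), of A] dvd_iff_dvd_coeffs[OF R(2) V(2), of B] by auto
  obtain m where
    m: "\<not> R dvd coeff (univariate i A) m" "\<And>l. l < m \<Longrightarrow> R dvd coeff (univariate i A) l"
    using exists_least_iff[THEN iffD1, OF nd(1)] by auto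
  obtain n where
    n: "\<not> R dvd coeff (univariate i B) n" "\<And>l. l < n \<Longrightarrow> R dvd coeff (univariate i B) l"
    using exists_least_iff[THEN iffD1, OF nd(2)] by auto
  let ?t = "\<lambda>l. coeff (univariate i A) l * coeff (univariate i B) (m + n - l)"
  have "R dvd (\<Sum>l\<le>m + n. ?t l)"
    using dvd dvd_iff_dvd_coeffs[OF R(2) V(2), of "A * B"] by (auto simp: univ_mult coeff_mult)
  moreover have "(\<Sum>l\<le>m + n. ?t l) = ?t m + (\<Sum>l\<in>{..m + n} - {m}. ?t l)"
    by (rule sum.remove) auto
  ultimately have "R dvd ?t m + (\<Sum>l\<in>{..m + n} - {m}. ?t l)"
    by (simp only:)
  moreover have "R dvd (\<Sum>l\<in>{..m + n} - {m}. ?t l)"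
  proof (rule dvd_sum)
    fix l assume "l \<in> {..m + n} - {m}"
    then have "l < m \<or> m + n - l < n" by auto
    then show "R dvd ?t l" using m(2) n(2) by auto
  qed
  ultimately have "R dvd coeff (univariate i A) m * coeff (univariate i B) n"
    by (simp add: dvd_add_left_iff)
  moreover have "coeff (univariate i A) m \<in> in_vars V" "coeff (univariate i B) n \<in> in_vars V"
    using A B by (auto intro: coeff_univ_in_vars)
  ultimately show False
    using V(1)[unfolded irreducibles_prime_def, rule_format, OF R, of "coeff (univariate i A) m"
        "coeff (univariate i B) n"] m(1) n(1) by auto
qed

text \<open>
  By Gauss's lemma every irreducible factor of \<open>C\<close> divides \<open>A\<close> or \<open>B\<close>, so the factors can be cancelled
  one after the other. This replaces clearing denominators in the fraction field of the
  coefficient ring.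
\<close>

lemma distribute_content:
  fixes P :: "('k::field, 'n::finite) mpoly"
  assumes V: "irreducibles_prime TYPE('k) V" "i \<notin> V"
    and "C \<in> in_vars V" "C \<noteq> 0" "P \<noteq> 0"
    and "A \<in> in_vars (insert i V)" "B \<in> in_vars (insert i V)"
    and "C * P = A * B"
  shows "\<exists>C1 C2 A' B'. C = C1 * C2 \<and> A = C1 * A' \<and> B = C2 * B' \<and> P = A' * B'"
  using assms(3-)
proof (induction "degree_sum C" arbitrary: C A B rule: less_induct)
  case less
  show ?case
  proof (cases "C dvd 1")
    case True
    then obtain E where E: "1 = C * E" ..
    have "P = (C * E) * P" using E by simp
    also have "\<dots> = E * (C * P)" by (simp add: mult_ac)
    also have "\<dots> = E * A * B" using less.prems(6) by (simp add: mult.assoc)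
    finally have "P = E * A * B" .
    moreover have "A = C * (E * A)" using E by (simp add: mult.assoc[symmetric])
    ultimately show ?thesis
      by (intro exI[of _ C] exI[of _ 1] exI[of _ "E * A"] exI[of _ B]) auto
  next
    case False
    with less.prems obtain R where R: "irreducible R" "R dvd C"
      using exists_irreducible_factor by blast
    then obtain D where D: "C = R * D" by auto
    then have in_V: "R \<in> in_vars V" "D \<in> in_vars V"
      using less.prems in_vars_factor[of R D V] by auto
    have nz: "R \<noteq> 0" "D \<noteq> 0" "A \<noteq> 0" "B \<noteq> 0"
      using less.prems D mpoly_mult_eq_0_iff[of C P] by auto
    have "degree_sum R \<noteq> 0"
      using R nz by (metis Const_0 degree_sum_eq_0_iff unit_iff_Const irreducible_not_unit)
    then have smaller: "degree_sum D < degree_sum C"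
      using D nz by (simp add: degree_sum_mult)
    have "R dvd A * B"
      using less.prems(6) D by (metis dvd_triv_left mult.assoc)
    then consider "R dvd A" | "R dvd B"
      using Gauss_lemma[OF V R(1) in_V(1)] less.prems by blast
    then show ?thesis
    proof cases
      case 1
      then obtain A0 where A0: "A = R * A0" ..
      have "R * (D * P) = A * B"
        using less.prems(6) D by (simp add: mult.assoc)
      also have "\<dots> = R * (A0 * B)"
        using A0 by (simp add: mult.assoc)
      finally have "D * P = A0 * B"
        by (rule mpoly_mult_left_cancel[OF nz(1)])
      moreover have "A0 \<in> in_vars (insert i V)"
        using A0 nz less.prems(4) in_vars_factor[of R A0] by auto
      ultimately obtain C1 C2 A' B' where
        "D = C1 * C2" "A0 = C1 * A'" "B = C2 * B'" "P = A' * B'"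
        using less.hyps[OF smaller in_V(2) nz(2) less.prems(3) _ less.prems(5)] by blast
      then show ?thesis
        using D A0
        by (intro exI[of _ "R * C1"] exI[of _ C2] exI[of _ A'] exI[of _ B']) (auto simp: mult_ac)
    next
      case 2
      then obtain B0 where B0: "B = R * B0" ..
      have "R * (D * P) = A * B"
        using less.prems(6) D by (simp add: mult.assoc)
      also have "\<dots> = R * (A * B0)"
        using B0 by (simp add: mult.left_commute)
      finally have "D * P = A * B0"
        by (rule mpoly_mult_left_cancel[OF nz(1)])
      moreover have "B0 \<in> in_vars (insert i V)"
        using B0 nz less.prems(5) in_vars_factor[of R B0] by auto
      ultimately obtain C1 C2 A' B' where
        "D = C1 * C2" "A = C1 * A'" "B0 = C2 * B'" "P = A' * B'"
        using less.hyps[OF smaller in_V(2) nz(2) less.prems(3,4)] by blast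
      then show ?thesis
        using D B0
        by (intro exI[of _ C1] exI[of _ "R * C2"] exI[of _ A'] exI[of _ B']) (auto simp: mult_ac)
    qed
  qed
qed

text \<open>
  An irreducible polynomial that involves \<open>x\<^sub>i\<close> is primitive, so polynomials without \<open>x\<^sub>i\<close> may be
  cancelled from divisibilities by it.
\<close>

lemma irreducible_cancel_content:
  fixes P :: "('k::field, 'n::finite) mpoly"
  assumes V: "irreducibles_prime TYPE('k) V" "i \<notin> V"
    and R: "irreducible R" "R \<in> in_vars (insert i V)" "degree (univariate i R) > 0"
    and C: "C \<in> in_vars V" "C \<noteq> 0" and P: "P \<in> in_vars (insert i V)"
    and "R dvd C * P"
  shows "R dvd P"
proof (cases "P = 0")
  case False
  from assms obtain Q where Q: "C * P = R * Q" by auto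
  have "C * P \<in> in_vars (insert i V)" "C * P \<noteq> 0"
    using C P False in_vars_mono[of V "insert i V"] by (auto simp: mpoly_mult_eq_0_iff)
  then have "Q \<in> in_vars (insert i V)"
    unfolding Q by (rule in_vars_factor)
  then obtain C1 C2 R' Q' where *: "C = C1 * C2" "R = C1 * R'" "P = R' * Q'"
    using distribute_content[OF V C False R(2) _ Q] by blast
  have nz: "R' \<noteq> 0" "C1 \<noteq> 0" using * False C by auto
  have "C1 \<in> in_vars V"
    using * C in_vars_factor by blast
  then have "degree (univariate i C1) = 0"
    using V by (simp add: in_vars_iff_degree)
  then have "\<not> R' dvd 1"
    using R(3) nz *(2) by (auto simp: degree_univ_mult unit_iff_Const)
  with R(1) * have "C1 dvd 1"
    by (auto simp: irreducible_def)
  then obtain E where "1 = C1 * E" ..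
  then have "R' = (C1 * E) * R'" by simp
  also have "\<dots> = (C1 * R') * E" by (simp add: mult_ac)
  finally have "R' = R * E" using *(2) by simp
  then have "R dvd R'" ..
  then show ?thesis
    using *(3) by simp
qed auto

text \<open>
  Division with remainder by \<open>D\<close> with respect to \<open>x\<^sub>i\<close> becomes possible after multiplication with a
  power of the leading coefficient of \<open>D\<close>. What matters is that multiplier and quotient stay in the
  variables \<open>V\<close> and \<open>insert i V\<close>.
\<close>

lemma pseudo_division:
  fixes P D :: "('k::idom, 'n::finite) mpoly"
  assumes "i \<notin> V" "D \<in> in_vars (insert i V)" "D \<noteq> 0" "P \<in> in_vars (insert i V)"
  shows "\<exists>C Q. C \<in> in_vars V \<and> C \<noteq> 0 \<and> Q \<in> in_vars (insert i V) \<and>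
    (C * P = D * Q \<or> degree (univariate i (C * P - D * Q)) < degree (univariate i D))"
  using assms(4)
proof (induction "degree (univariate i P)" arbitrary: P rule: less_induct)
  case less
  show ?case
  proof (cases "degree (univariate i P) < degree (univariate i D)")
    case True
    then show ?thesis by (intro exI[of _ 1] exI[of _ 0]) auto
  next
    case False
    define L where "L = lead_coeff (univariate i D)"
    define l where "l = lead_coeff (univariate i P)"
    define k where "k = degree (univariate i P) - degree (univariate i D)"
    define P' where "P' = L * P - D * (l * Var i ^ k)"
    have L: "L \<in> in_vars V" "L \<noteq> 0" and l: "l \<in> in_vars V"
      using assms less.prems by (auto simp: L_def l_def intro: coeff_univ_in_vars)
    have L': "L \<in> in_vars (insert i V)" and l': "l \<in> in_vars (insert i V)"
      using L l by (auto intro: in_vars_mono[of V])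
    have Q: "l * Var i ^ k \<in> in_vars (insert i V)"
      using l' by (auto intro!: in_vars_mult in_vars_power in_vars_Var)
    have P': "P' \<in> in_vars (insert i V)"
      unfolding P'_def using L' less.prems assms(2) Q by auto
    have univ_P': "univariate i P' = smult L (univariate i P) - smult l (monom 1 k * univariate i D)"
      using assms(1) L l
      by (simp add: P'_def univ_diff univ_mult univ_power univ_Var univ_const[of _ V]
          monom_altdef mult_ac)
    have "degree (univariate i P') \<le> degree (univariate i P)"
    proof -
      have "degree (monom 1 k * univariate i D) \<le> degree (univariate i P)"
        using False degree_mult_le[of "monom 1 k" "univariate i D"]
          degree_monom_le[of "1 :: ('k, 'n) mpoly" k] by (simp add: k_def)
      then show ?thesis
        unfolding univ_P' by (intro degree_diff_le order_trans[OF degree_smult_le]) auto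
    qed
    moreover have "coeff (univariate i P') (degree (univariate i P)) = 0"
      using False by (simp add: univ_P' coeff_monom_mult L_def l_def k_def)
    ultimately consider "P' = 0" | "degree (univariate i P') < degree (univariate i P)"
      by (metis le_neq_implies_less leading_coeff_0_iff univ_eq_0_iff)
    then show ?thesis
    proof cases
      case 1
      then show ?thesis
        using L Q by (intro exI[of _ L] exI[of _ "l * Var i ^ k"]) (auto simp: P'_def)
    next
      case 2
      then obtain C' Q' where *: "C' \<in> in_vars V" "C' \<noteq> 0" "Q' \<in> in_vars (insert i V)"
        "C' * P' = D * Q' \<or> degree (univariate i (C' * P' - D * Q')) < degree (univariate i D)"
        using less.hyps[OF 2 P'] by blast
      have eq: "C' * P' - D * Q' = C' * L * P - D * (Q' + C' * (l * Var i ^ k))"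
        by (simp add: P'_def algebra_simps)
      have "C' * P' = D * Q' \<longleftrightarrow> C' * L * P = D * (Q' + C' * (l * Var i ^ k))"
        using eq by (metis eq_iff_diff_eq_0)
      moreover have "Q' + C' * (l * Var i ^ k) \<in> in_vars (insert i V)"
        using * Q by (auto intro!: in_vars_add in_vars_mult in_vars_mono[of V "insert i V" C'])
      ultimately show ?thesis
        using * L eq by (intro exI[of _ "C' * L"] exI[of _ "Q' + C' * (l * Var i ^ k)"])
          (auto simp: mpoly_mult_eq_0_iff)
    qed
  qed
qed

text \<open>
  Induction on the variables. An irreducible \<open>R\<close> without the new variable \<open>x\<^sub>i\<close> is covered by Gauss's
  lemma. If \<open>R\<close> involves \<open>x\<^sub>i\<close>, the proof imitates the Euclidean argument over the fraction field of
  the coefficients: a nonzero element \<open>D\<close> of least degree in \<open>x\<^sub>i\<close> in the ideal generated by \<open>R\<close> and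
  \<open>A\<close> divides both up to factors without \<open>x\<^sub>i\<close>.
  Irreducibility of \<open>R\<close> leaves two cases. Either \<open>R\<close> divides \<open>D\<close> and hence \<open>A\<close>, or \<open>D\<close> is itself free
  of \<open>x\<^sub>i\<close> up to a unit, and then \<open>D * B\<close>, which is a multiple of \<open>R\<close>, shows that \<open>R\<close> divides \<open>B\<close>.
\<close>

lemma irreducibles_prime_in_vars:
  fixes V :: "'n::finite set"
  assumes "finite V"
  shows "irreducibles_prime TYPE('k::field) V"
  using assms
proof (induction V rule: finite_induct)
  case empty
  then show ?case
    by (auto simp: irreducibles_prime_def in_vars_empty irreducible_def unit_iff_Const)
next
  case (insert i V)
  note V = insert.IH insert.hyps(2)
  let ?S = "in_vars (insert i V) :: ('k, 'n) mpoly set"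
  have "R dvd A \<or> R dvd B"
    if R: "irreducible R" "R \<in> ?S" and A: "A \<in> ?S" and B: "B \<in> ?S" and dvd: "R dvd A * B"
    for R A B
  proof (cases "degree (univariate i R) = 0")
    case True
    then have "R \<in> in_vars V"
      using R(2) unfolding in_vars_iff_degree by (metis insert_iff)
    then show ?thesis
      using Gauss_lemma[OF V R(1)] A B dvd by blast
  next
    case False
    show ?thesis
    proof (rule disjCI)
      assume nB: "\<not> R dvd B"
      show "R dvd A"
      proof (rule ccontr)
        assume nA: "\<not> R dvd A"
        define J where "J D \<longleftrightarrow> D \<in> ?S \<and> D \<noteq> 0 \<and> (\<exists>S T. D = R * S + A * T)" for D
        have "R = R * 1 + A * 0" by simp
        then have "J R"
          using R unfolding J_def irreducible_def by blast
        then obtain D where D: "J D" and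
          least: "\<And>D'. J D' \<Longrightarrow> degree (univariate i D) \<le> degree (univariate i D')"
          using ex_has_least_nat[of J R "\<lambda>D. degree (univariate i D)"] by blast
        then obtain S T where ST: "D = R * S + A * T" and D': "D \<in> ?S" "D \<noteq> 0"
          by (auto simp: J_def)
        have divides: "\<exists>C Q. C \<in> in_vars V \<and> C \<noteq> 0 \<and> Q \<in> ?S \<and> C * P = D * Q"
          if P: "P \<in> ?S" "\<exists>S T. P = R * S + A * T" for P
        proof -
          obtain C Q where CQ: "C \<in> in_vars V" "C \<noteq> 0" "Q \<in> ?S"
            "C * P = D * Q \<or> degree (univariate i (C * P - D * Q)) < degree (univariate i D)"
            using pseudo_division[OF V(2) D' P(1)] by blast
          have "C * P - D * Q \<in> ?S"
            using CQ P(1) D' in_vars_mono[of V "insert i V" C] by auto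
          moreover have "\<exists>S T. C * P - D * Q = R * S + A * T"
          proof -
            obtain S' T' where "P = R * S' + A * T'" using P(2) by blast
            then have "C * P - D * Q = R * (C * S' - S * Q) + A * (C * T' - T * Q)"
              using ST by (simp add: algebra_simps)
            then show ?thesis by blast
          qed
          ultimately have "C * P = D * Q \<or> J (C * P - D * Q)" by (auto simp: J_def)
          then have "C * P = D * Q"
            using least[of "C * P - D * Q"] CQ(4) by auto
          with CQ show ?thesis by blast
        qed
        obtain C Q where CQ: "C \<in> in_vars V" "C \<noteq> 0" "Q \<in> ?S" "C * R = D * Q"
          using divides[of R] R(2) by (metis add.right_neutral mult.right_neutral mult_zero_right)
        obtain C1 C2 D1 Q1 where *: "C = C1 * C2" "D = C1 * D1" "R = D1 * Q1"
          using distribute_content[OF V CQ(1,2) _ D'(1) CQ(3,4)] R(1) by (auto simp: irreducible_def)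
        have C1: "C1 \<in> in_vars V" "C1 \<noteq> 0"
          using * CQ in_vars_factor[of C1 C2 V] by auto
        consider "Q1 dvd 1" | "D1 dvd 1"
          using irreducibleD[OF R(1) *(3)] by blast
        then show False
        proof cases
          case 1
          then obtain E where "1 = Q1 * E" ..
          then have "D1 = R * E" using *(3) by (metis mult.assoc mult_1_right)
          then have "R dvd D1" ..
          then have "R dvd D" using *(2) by simp
          moreover obtain C' Q' where C': "C' \<in> in_vars V" "C' \<noteq> 0" "C' * A = D * Q'"
            using divides[of A] A by (metis add.left_neutral mult.right_neutral mult_zero_right)
          ultimately have "R dvd C' * A" by simp
          then show False
            using irreducible_cancel_content[OF V R, of C' A] C' False A nA by auto
        next
          case 2
          then obtain E where "1 = D1 * E" ..
          then have "C1 = D * E" using *(2) by (metis mult.assoc mult_1_right)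
          then have "C1 * B = R * (S * B * E) + (A * B) * (T * E)"
            using ST by (simp add: algebra_simps)
          then have "R dvd C1 * B" using dvd by simp
          then show False
            using irreducible_cancel_content[OF V R, of C1 B] False B C1 nB by auto
        qed
      qed
    qed
  qed
  then show ?case
    unfolding irreducibles_prime_def by blast
qed

theorem irreducible_imp_prime_elem_mpoly:
  fixes P :: "('k::field, 'n::finite) mpoly"
  assumes "irreducible P"
  shows "prime_elem P"
  using irreducibles_prime_in_vars[OF finite, where V = "UNIV :: 'n set" and 'k = 'k] assms
  by (auto simp: prime_elem_def irreducibles_prime_def irreducible_def)

section \<open>Derivatives and the Jacobian\<close>

lemma partial_deriv_superset:
  assumes "finite S" "Poly_Mapping.keys P \<subseteq> S"
  shows "partial_deriv i P = (\<Sum>m\<in>S. Poly_Mapping.single (m - Poly_Mapping.single i 1)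
      (of_nat (Poly_Mapping.lookup m i) * Poly_Mapping.lookup P m))"
  unfolding partial_deriv_def
  by (rule sum.mono_neutral_left) (use assms in \<open>auto simp: in_keys_iff\<close>)

lemma partial_deriv_add: "partial_deriv i (P + Q) = partial_deriv i P + partial_deriv i Q"
proof -
  let ?S = "Poly_Mapping.keys P \<union> Poly_Mapping.keys Q"
  have "Poly_Mapping.keys (P + Q) \<subseteq> ?S"
    by (rule keys_add)
  then show ?thesis
    by (simp add: partial_deriv_superset[of ?S] lookup_add distrib_left single_add sum.distrib)
qed

lemma partial_deriv_single:
  "partial_deriv i (Poly_Mapping.single m c) =
    Poly_Mapping.single (m - Poly_Mapping.single i 1) (of_nat (Poly_Mapping.lookup m i) * c)"
  by (subst partial_deriv_superset[of "{m}"]) auto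

lemma partial_deriv_0 [simp]: "partial_deriv i 0 = 0"
  by (simp add: partial_deriv_def)

lemma partial_deriv_Const [simp]: "partial_deriv i (Const c) = 0"
  by (simp add: Const_def partial_deriv_single)

lemma partial_deriv_Var: "partial_deriv i (Var j) = (if i = j then 1 else 0)"
  by (simp add: Var_def partial_deriv_single lookup_single when_def)

lemma partial_deriv_sum: "partial_deriv i (\<Sum>a\<in>A. F a) = (\<Sum>a\<in>A. partial_deriv i (F a))"
  by (induction A rule: infinite_finite_induct) (simp_all add: partial_deriv_add)

text \<open>
  Both sides are bilinear, so it suffices to compare monomials, where the truncated subtraction of
  exponents is harmless because the coefficient vanishes in that case.
\<close>

lemma partial_deriv_mult:
  fixes P Q :: "('k::comm_ring_1, 'n::finite) mpoly"
  shows "partial_deriv i (P * Q) = partial_deriv i P * Q + P * partial_deriv i Q"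
proof -
  have mono: "partial_deriv i (Poly_Mapping.single m c * Poly_Mapping.single n d)
      = partial_deriv i (Poly_Mapping.single m c) * Poly_Mapping.single n d
        + Poly_Mapping.single m c * partial_deriv i (Poly_Mapping.single n d)"
    for m n :: "'n \<Rightarrow>\<^sub>0 nat" and c d :: 'k
  proof -
    have shift: "p - Poly_Mapping.single i 1 + q = p + q - Poly_Mapping.single i 1"
      if "Poly_Mapping.lookup p i \<noteq> 0" for p q :: "'n \<Rightarrow>\<^sub>0 nat"
      using that by (intro poly_mapping_eqI)
        (auto simp: lookup_add lookup_minus lookup_single when_def)
    have 1: "Poly_Mapping.single (m - Poly_Mapping.single i 1 + n) (of_nat (Poly_Mapping.lookup m i) * c * d)
        = Poly_Mapping.single (m + n - Poly_Mapping.single i 1) (of_nat (Poly_Mapping.lookup m i) * c * d)"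
      by (cases "Poly_Mapping.lookup m i = 0") (simp_all add: shift del: One_nat_def)
    have 2: "Poly_Mapping.single (m + (n - Poly_Mapping.single i 1)) (c * (of_nat (Poly_Mapping.lookup n i) * d))
        = Poly_Mapping.single (m + n - Poly_Mapping.single i 1) (c * (of_nat (Poly_Mapping.lookup n i) * d))"
      using shift[of n m] by (cases "Poly_Mapping.lookup n i = 0") (simp_all add: add.commute del: One_nat_def)
    show ?thesis
      unfolding mult_single partial_deriv_single 1 2 single_add[symmetric]
      by (simp add: lookup_add algebra_simps)
  qed
  have "partial_deriv i ((\<Sum>m\<in>A. Poly_Mapping.single m (f m)) * (\<Sum>n\<in>B. Poly_Mapping.single n (g n)))
      = partial_deriv i (\<Sum>m\<in>A. Poly_Mapping.single m (f m)) * (\<Sum>n\<in>B. Poly_Mapping.single n (g n))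
        + (\<Sum>m\<in>A. Poly_Mapping.single m (f m)) * partial_deriv i (\<Sum>n\<in>B. Poly_Mapping.single n (g n))"
    for A B :: "('n \<Rightarrow>\<^sub>0 nat) set" and f g :: "('n \<Rightarrow>\<^sub>0 nat) \<Rightarrow> 'k"
    by (simp only: sum_product partial_deriv_sum mono sum.distrib)
  from this[where A = "Poly_Mapping.keys P" and f = "Poly_Mapping.lookup P"
      and B = "Poly_Mapping.keys Q" and g = "Poly_Mapping.lookup Q"]
  show ?thesis
    by (simp add: sum_single_keys[symmetric])
qed

text \<open>
  The chain rule holds for constants and indeterminates, and both sides behave in the same way under
  sums and products.
\<close>

lemma partial_deriv_compose:
  "partial_deriv j (compose_mpoly f P) =
    (\<Sum>i\<in>UNIV. compose_mpoly f (partial_deriv i P) * partial_deriv j (f $ i))"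
  unfolding compose_mpoly_def
proof (induction P rule: mpoly_induct)
  case (Var k)
  have "(\<Sum>i\<in>UNIV. subst Const (($) f) (partial_deriv i (Var k)) * partial_deriv j (f $ i))
      = (\<Sum>i\<in>UNIV. if i = k then partial_deriv j (f $ i) else 0)"
    by (rule sum.cong) (auto simp: partial_deriv_Var)
  then show ?case by simp
next
  case (add P R)
  then show ?case
    by (simp add: comp.subst_add partial_deriv_add sum.distrib distrib_right)
next
  case (mult P R)
  then show ?case
    by (simp add: comp.subst_add comp.subst_mult partial_deriv_add partial_deriv_mult
        sum.distrib sum_distrib_left sum_distrib_right algebra_simps)
qed simp

lemma eval_det:
  fixes A :: "('k::comm_ring_1, 'n::finite) mpoly ^ 'n ^ 'n"
  shows "eval_mpoly (det A) x = det (\<chi> i j. eval_mpoly (A $ i $ j) x)"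
proof -
  have "eval_mpoly (of_int (sign p)) x = of_int (sign p)" for p :: "'n \<Rightarrow> 'n"
    by (simp add: sign_def)
  then show ?thesis
    by (simp add: det_def eval_sum eval_prod)
qed

lemma compose_inverse:
  fixes f g :: "('k::alg_closed_field, 'n::finite) mpoly ^ 'n"
  assumes "\<And>x. poly_map g (poly_map f x) = x"
  shows "compose_mpoly f (g $ i) = Var i"
proof (rule eval_eqI[OF infinite_UNIV_alg_closed])
  fix x
  have "poly_map g (poly_map f x) $ i = x $ i"
    by (simp add: assms)
  then show "eval_mpoly (compose_mpoly f (g $ i)) x = eval_mpoly (Var i) x"
    by (simp add: eval_compose_mpoly poly_map_def[of g])
qed

text \<open>
  By the chain rule the Jacobian matrices of \<open>g \<circ> f = id\<close> multiply to the identity, so \<open>Jac f\<close> is a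
  unit of the polynomial ring.
\<close>

lemma Jac_automorphism:
  fixes f :: "('k::alg_closed_field, 'n::finite) mpoly ^ 'n"
  assumes "poly_automorphism f"
  obtains c where "Jac f = Const c"
proof -
  obtain g where g: "\<And>x. poly_map g (poly_map f x) = x"
    using assms by (auto simp: poly_automorphism_def)
  define A where "A = (\<chi> i k. compose_mpoly f (partial_deriv k (g $ i)))"
  have "A ** (\<chi> i j. partial_deriv j (f $ i)) = mat 1"
    by (simp add: A_def matrix_matrix_mult_def mat_def vec_eq_iff partial_deriv_compose[symmetric]
        compose_inverse[OF g] partial_deriv_Var)
  then have "det A * Jac f = 1"
    by (metis Jac_def det_mul det_I)
  then have "Jac f dvd 1"
    by (metis dvd_triv_right)
  then show ?thesis
    using that by (auto simp: unit_iff_Const)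
qed

text \<open>
  By multilinearity in the rows, one row after the other is changed from a unit vector to its final
  form. The correction term in each step is the determinant with that row replaced by \<open>b\<close>
  (\<open>replaced\<close>); multiples of \<open>b\<close> in the other rows do not affect it.
\<close>

lemma det_identity_plus_rank_one:
  fixes a b :: "'k::field ^ 'n::finite"
  shows "det (\<chi> i. axis i 1 + a $ i *s b) = 1 + (\<Sum>i\<in>UNIV. a $ i * b $ i)"
proof -
  define r where "r S i = (if i \<in> S then axis i 1 + a $ i *s b else axis i 1)" for S i
  have replaced: "det (\<chi> i. if i = k then b else r S i) = b $ k" if "finite S" "k \<notin> S" for S k
    using that
  proof (induction S rule: finite_induct)
    case empty
    have row: "row i (mat 1 :: 'k^'n^'n) = axis i 1" for i
      by (auto simp: row_def mat_def axis_def vec_eq_iff)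
    have "(\<Sum>i\<in>UNIV. b $ i *s row i (mat 1 :: 'k^'n^'n)) = b"
      unfolding row by (rule basis_expansion)
    note sum = this[unfolded row]
    show ?case
      using cramer_lemma_transpose[of k b "mat 1"] unfolding row sum by (simp add: r_def cong: if_cong)
  next
    case (insert j S)
    define c where "c i = (if i = k then b else r S i)" for i
    have "(\<chi> i. if i = k then b else r (insert j S) i)
        = (\<chi> i. if i = j then axis j 1 + a $ j *s b else c i)"
      using insert by (auto simp: vec_eq_iff r_def c_def)
    moreover have "(\<chi> i. if i = j then axis j 1 else c i) = (\<chi> i. c i)"
      using insert by (auto simp: vec_eq_iff r_def c_def)
    moreover have "det (\<chi> i. if i = j then b else c i) = 0"
      using insert by (intro det_identical_rows[of j k]) (auto simp: row_def c_def)
    ultimately show ?case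
      using insert by (simp add: det_row_add det_row_mul c_def)
  qed
  have "det (\<chi> i. r S i) = 1 + (\<Sum>i\<in>S. a $ i * b $ i)" if "finite S" for S
    using that
  proof (induction S rule: finite_induct)
    case empty
    have "(\<chi> i. r {} i) = mat 1"
      by (auto simp: r_def mat_def axis_def vec_eq_iff)
    then show ?case by simp
  next
    case (insert j S)
    have "(\<chi> i. r (insert j S) i) = (\<chi> i. if i = j then axis j 1 + a $ j *s b else r S i)"
      by (auto simp: vec_eq_iff r_def)
    moreover have "(\<chi> i. if i = j then axis j 1 else r S i) = (\<chi> i. r S i)"
      using insert by (auto simp: vec_eq_iff r_def)
    ultimately show ?case
      using insert by (simp add: det_row_add det_row_mul replaced)
  qed
  from this[of UNIV] show ?thesis
    by (simp add: r_def)
qed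

section \<open>Chains of prime ideals\<close>

definition prime_ideal :: "'a::comm_ring_1 set \<Rightarrow> bool" where
  "prime_ideal I \<longleftrightarrow> 0 \<in> I \<and> (\<forall>a\<in>I. \<forall>b\<in>I. a + b \<in> I) \<and> (\<forall>a\<in>I. \<forall>r. r * a \<in> I) \<and>
     1 \<notin> I \<and> (\<forall>a b. a * b \<in> I \<longrightarrow> a \<in> I \<or> b \<in> I)"

lemma prime_idealD:
  assumes "prime_ideal I"
  shows "0 \<in> I" "a \<in> I \<Longrightarrow> b \<in> I \<Longrightarrow> a + b \<in> I" "a \<in> I \<Longrightarrow> r * a \<in> I" "1 \<notin> I"
    "a * b \<in> I \<Longrightarrow> a \<in> I \<or> b \<in> I"
  using assms unfolding prime_ideal_def by blast+

lemma prime_ideal_diff: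
  assumes "prime_ideal I" "a \<in> I" "b \<in> I"
  shows "a - b \<in> I"
  using prime_idealD(2)[OF assms(1,2) prime_idealD(3)[OF assms(1,3), of "-1"]] by simp

lemma prime_ideal_dvd:
  assumes "prime_ideal I" "a \<in> I" "a dvd b"
  shows "b \<in> I"
  using assms(3) prime_idealD(3)[OF assms(1,2)] by (auto simp: dvd_def mult.commute)

lemma prime_ideal_power: "prime_ideal I \<Longrightarrow> a ^ n \<in> I \<Longrightarrow> a \<in> I"
  by (induction n) (auto dest: prime_idealD)

text \<open>
  A list of length \<open>k\<close> encodes the exponents of a monomial in \<open>y\<^sub>0, \<dots>, y\<^bsub>k-1\<^esub>\<close>, with the exponent of
  \<open>y\<^bsub>k-1\<^esub>\<close> first, so that adjoining a new variable is consing.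
\<close>

fun list_monomial :: "(nat \<Rightarrow> 'a::comm_monoid_mult) \<Rightarrow> nat list \<Rightarrow> 'a" where
  "list_monomial y [] = 1"
| "list_monomial y (a # l) = y (length l) ^ a * list_monomial y l"

definition exponents :: "nat \<Rightarrow> nat \<Rightarrow> nat list set" where
  "exponents D k = {l. set l \<subseteq> {..D} \<and> length l = k}"

lemma finite_exponents [simp]: "finite (exponents D k)"
  and card_exponents: "card (exponents D k) = (D + 1) ^ k"
  by (simp_all add: exponents_def finite_lists_length_eq card_lists_length_eq)

lemma exponents_0: "exponents D 0 = {[]}"
  by (auto simp: exponents_def)

lemma exponents_Suc: "exponents D (Suc k) = (\<lambda>(a, l). a # l) ` ({..D} \<times> exponents D k)"
  by (auto simp: exponents_def length_Suc_conv image_iff)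

lemma sum_exponents_Suc:
  "(\<Sum>l\<in>exponents D (Suc k). F l) = (\<Sum>a\<le>D. \<Sum>l\<in>exponents D k. F (a # l))"
proof -
  have "inj_on (\<lambda>(a, l). a # l) ({..D} \<times> exponents D k)"
    by (auto simp: inj_on_def)
  then show ?thesis
    by (simp only: exponents_Suc sum.reindex sum.cartesian_product) (simp add: case_prod_beta)
qed

text \<open>
  Take \<open>y\<^sub>k\<close> in the \<open>k\<close>-th but not in the next ideal of a descending chain of primes. Then the monomials
  in \<open>y\<^sub>0, \<dots>, y\<^bsub>k-1\<^esub>\<close> are linearly independent modulo \<open>I k\<close>. In a relation modulo \<open>I (Suc k)\<close> the lowest
  power of \<open>y\<^sub>k\<close> can be cancelled since \<open>y\<^sub>k\<close> is not in this prime; then, modulo the larger ideal \<open>I k\<close>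
  that does contain \<open>y\<^sub>k\<close>, only its lowest coefficient survives, which is a relation between
  \<open>y\<^sub>0, \<dots>, y\<^bsub>k-1\<^esub>\<close>.
\<close>

lemma prime_chain_independent:
  fixes y :: "nat \<Rightarrow> ('k::field, 'n::finite) mpoly"
  assumes prime: "\<And>k. k \<le> N \<Longrightarrow> prime_ideal (I k)"
    and mono: "\<And>k. k < N \<Longrightarrow> I (Suc k) \<subseteq> I k"
    and y: "\<And>k. k < N \<Longrightarrow> y k \<in> I k" "\<And>k. k < N \<Longrightarrow> y k \<notin> I (Suc k)"
    and "k \<le> N"
    and "(\<Sum>l\<in>exponents D k. Const (c l) * list_monomial y l) \<in> I k" and "l \<in> exponents D k"
  shows "c l = 0"
  using assms(5-)
proof (induction k arbitrary: c l)
  case 0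
  show ?case
  proof (rule ccontr)
    assume "c l \<noteq> 0"
    then have "Const (inverse (c [])) * Const (c []) = (1 :: ('k, 'n) mpoly)"
      using 0 by (simp add: Const_mult[symmetric] exponents_0)
    moreover have "Const (c []) \<in> I 0"
      using 0 by (simp add: exponents_0)
    ultimately have "1 \<in> I 0"
      using prime_idealD(3)[OF prime] by (metis le0)
    then show False using prime_idealD(4)[OF prime] by blast
  qed
next
  case (Suc k)
  define s where "s a = (\<Sum>l\<in>exponents D k. Const (c (a # l)) * list_monomial y l)" for a
  have k: "k < N" "k \<le> N" "Suc k \<le> N" using Suc.prems by auto
  have len: "length l = k" if "l \<in> exponents D k" for l
    using that by (simp add: exponents_def)
  have total: "(\<Sum>a\<le>D. y k ^ a * s a) \<in> I (Suc k)"
    using Suc.prems(2)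
    by (simp add: sum_exponents_Suc s_def sum_distrib_left len mult_ac cong: sum.cong)
  have zero: "\<forall>l\<in>exponents D k. c (a # l) = 0" if "a \<le> D" for a
    using that
  proof (induction a rule: less_induct)
    case (less a)
    have low: "s b = 0" if "b < a" for b
      using less that by (simp add: s_def)
    have "(\<Sum>b\<le>D. y k ^ b * s b) = (\<Sum>b\<in>{a..D}. y k ^ b * s b)"
      by (rule sum.mono_neutral_right) (auto simp: low)
    also have "{a..D} = insert a {a<..D}"
      using less.prems by auto
    also have "(\<Sum>b\<in>insert a {a<..D}. y k ^ b * s b)
        = y k ^ a * s a + (\<Sum>b\<in>{a<..D}. y k ^ a * (y k * (y k ^ (b - a - 1) * s b)))"
    proof -
      have "y k ^ b = y k ^ a * (y k * y k ^ (b - a - 1))" if "b \<in> {a<..D}" for b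
      proof -
        have "b = a + Suc (b - a - 1)" using that by auto
        then show ?thesis by (metis power_add power_Suc)
      qed
      then show ?thesis by (simp add: mult.assoc)
    qed
    also have "\<dots> = y k ^ a * (s a + y k * (\<Sum>b\<in>{a<..D}. y k ^ (b - a - 1) * s b))"
      by (simp add: sum_distrib_left distrib_left)
    finally have "y k ^ a * (s a + y k * (\<Sum>b\<in>{a<..D}. y k ^ (b - a - 1) * s b)) \<in> I (Suc k)"
      using total by simp
    then have "s a + y k * (\<Sum>b\<in>{a<..D}. y k ^ (b - a - 1) * s b) \<in> I (Suc k)"
      using prime_idealD(5)[OF prime[OF k(3)]] prime_ideal_power[OF prime[OF k(3)]] y(2)[OF k(1)]
      by blast
    then have "s a + y k * (\<Sum>b\<in>{a<..D}. y k ^ (b - a - 1) * s b) \<in> I k"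
      using mono[OF k(1)] by blast
    moreover have "y k * (\<Sum>b\<in>{a<..D}. y k ^ (b - a - 1) * s b) \<in> I k"
      using prime_idealD(3)[OF prime[OF k(2)] y(1)[OF k(1)]] by (simp add: mult.commute[of "y k"])
    ultimately have "s a \<in> I k"
      using prime_ideal_diff[OF prime[OF k(2)]] by fastforce
    then show ?case
      using Suc.IH[OF k(2), of "\<lambda>l. c (a # l)"] by (simp add: s_def)
  qed
  then show ?case
    using Suc.prems(3) by (auto simp: exponents_Suc)
qed

definition exps_le :: "nat \<Rightarrow> ('k::comm_ring_1, 'n::finite) mpoly \<Rightarrow> bool" where
  "exps_le B P \<longleftrightarrow> (\<forall>m\<in>Poly_Mapping.keys P. \<forall>i. Poly_Mapping.lookup m i \<le> B)"

lemma exps_le_1: "exps_le B 1"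
  by (simp add: exps_le_def)

lemma exps_le_mult:
  assumes "exps_le A P" "exps_le B Q"
  shows "exps_le (A + B) (P * Q)"
  unfolding exps_le_def
proof (intro ballI allI)
  fix m i assume "m \<in> Poly_Mapping.keys (P * Q)"
  then obtain p q where "m = p + q" "p \<in> Poly_Mapping.keys P" "q \<in> Poly_Mapping.keys Q"
    using keys_mult[of P Q] by blast
  then show "Poly_Mapping.lookup m i \<le> A + B"
    using assms by (auto simp: exps_le_def lookup_add intro!: add_mono)
qed

lemma exps_le_mono: "exps_le A P \<Longrightarrow> A \<le> B \<Longrightarrow> exps_le B P"
  unfolding exps_le_def using le_trans by blast

lemma exps_le_power: "exps_le B P \<Longrightarrow> exps_le (n * B) (P ^ n)"
  by (induction n) (auto intro: exps_le_1 exps_le_mult)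

lemma exps_le_list_monomial:
  assumes "\<And>k. k < length l \<Longrightarrow> exps_le d (y k)" "set l \<subseteq> {..D}"
  shows "exps_le (length l * (D * d)) (list_monomial y l)"
  using assms
proof (induction l)
  case (Cons a l)
  have "exps_le (D * d) (y (length l) ^ a)"
    using Cons.prems by (intro exps_le_mono[OF exps_le_power[of d]]) auto
  moreover have "exps_le (length l * (D * d)) (list_monomial y l)"
    using Cons.prems by (intro Cons.IH) auto
  ultimately show ?case
    using exps_le_mult by fastforce
qed (simp add: exps_le_1)

lemma exists_exps_le:
  fixes y :: "nat \<Rightarrow> ('k::comm_ring_1, 'n::finite) mpoly"
  shows "\<exists>d. \<forall>k<N. exps_le d (y k)"
proof -
  have "\<exists>d. exps_le d P" for P :: "('k, 'n) mpoly"
  proof (intro exI, unfold exps_le_def, intro ballI allI)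
    fix m i assume "m \<in> Poly_Mapping.keys P"
    have "Poly_Mapping.lookup m i \<le> (\<Sum>i\<in>UNIV. Poly_Mapping.lookup m i)"
      by (rule member_le_sum) auto
    also have "\<dots> \<le> (\<Sum>m\<in>Poly_Mapping.keys P. \<Sum>i\<in>UNIV. Poly_Mapping.lookup m i)"
      using \<open>m \<in> Poly_Mapping.keys P\<close> by (intro member_le_sum) auto
    finally show "Poly_Mapping.lookup m i \<le> \<dots>" .
  qed
  then have "\<forall>k. \<exists>d. exps_le d (y k)" by blast
  then obtain d where d: "\<And>k. exps_le (d k) (y k)"
    using choice[of "\<lambda>k d. exps_le d (y k)"] by blast
  have "exps_le (\<Sum>k<N. d k) (y k)" if "k < N" for k
    using that by (intro exps_le_mono[OF d] member_le_sum) auto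
  then show ?thesis by blast
qed

definition box_monomials :: "nat \<Rightarrow> ('k::comm_ring_1, 'n::finite) mpoly set" where
  "box_monomials B = (\<lambda>m. Poly_Mapping.single m 1) ` {m. \<forall>i. Poly_Mapping.lookup m i \<le> B}"

lemma finite_box_monomials: "finite (box_monomials B :: ('k::comm_ring_1, 'n::finite) mpoly set)"
  and card_box_monomials:
    "card (box_monomials B :: ('k::comm_ring_1, 'n::finite) mpoly set) \<le> (B + 1) ^ CARD('n)"
proof -
  let ?E = "{m :: 'n \<Rightarrow>\<^sub>0 nat. \<forall>i. Poly_Mapping.lookup m i \<le> B}"
  have sub: "Poly_Mapping.lookup ` ?E \<subseteq> (UNIV :: 'n set) \<rightarrow>\<^sub>E {..B}"
    by auto
  have inj: "inj_on Poly_Mapping.lookup ?E"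
    by (rule inj_onI) (rule poly_mapping_eqI, simp)
  have fin: "finite ((UNIV :: 'n set) \<rightarrow>\<^sub>E {..B})"
    by (rule finite_PiE) auto
  have finE: "finite ?E"
    using finite_subset[OF sub fin] inj by (rule finite_imageD)
  then show "finite (box_monomials B :: ('k, 'n) mpoly set)"
    by (simp add: box_monomials_def)
  have "card (box_monomials B :: ('k, 'n) mpoly set) \<le> card ?E"
    unfolding box_monomials_def by (rule card_image_le[OF finE])
  also have "\<dots> = card (Poly_Mapping.lookup ` ?E)"
    using inj by (simp add: card_image)
  also have "\<dots> \<le> (B + 1) ^ CARD('n)"
    using card_mono[OF fin sub] by (simp add: card_PiE)
  finally show "card (box_monomials B :: ('k, 'n) mpoly set) \<le> (B + 1) ^ CARD('n)" .
qed

interpretation mpoly_vs: vector_space "\<lambda>c (P :: ('k::field, 'n::finite) mpoly). Const c * P"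
  by standard (simp_all add: algebra_simps Const_add Const_mult)

lemma exps_le_in_span:
  assumes "exps_le B P"
  shows "P \<in> mpoly_vs.span (box_monomials B)"
proof -
  have "Poly_Mapping.single m (Poly_Mapping.lookup P m) \<in> mpoly_vs.span (box_monomials B)"
    if "m \<in> Poly_Mapping.keys P" for m
  proof -
    have "Poly_Mapping.single m 1 \<in> mpoly_vs.span (box_monomials B)"
      using that assms by (intro mpoly_vs.span_base) (auto simp: box_monomials_def exps_le_def)
    from mpoly_vs.span_scale[OF this, of "Poly_Mapping.lookup P m"] show ?thesis
      by (simp add: Const_def mult_single)
  qed
  then have "(\<Sum>m\<in>Poly_Mapping.keys P. Poly_Mapping.single m (Poly_Mapping.lookup P m))
      \<in> mpoly_vs.span (box_monomials B)"
    by (rule mpoly_vs.span_sum)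
  then show ?thesis
    by (simp add: sum_single_keys[symmetric])
qed

text \<open>
  Such a chain would yield $n + 1$ elements $y_0, \dots, y_n$ that are algebraically independent over
  the field, by \<open>prime_chain_independent\<close> at the last ideal. There are $(D + 1)^{n + 1}$ monomials
  in them with exponents at most $D$, but all of these lie in the span of $O(D^n)$ monomials in the
  $n$ indeterminates.
\<close>

theorem no_long_prime_chain:
  fixes I :: "nat \<Rightarrow> ('k::field, 'n::finite) mpoly set"
  assumes prime: "\<And>k. k \<le> CARD('n) + 1 \<Longrightarrow> prime_ideal (I k)"
    and strict: "\<And>k. k < CARD('n) + 1 \<Longrightarrow> I (Suc k) \<subset> I k"
  shows False
proof -
  define N where "N = CARD('n) + 1"
  have "\<exists>P. P \<in> I k \<and> P \<notin> I (Suc k)" if "k < N" for k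
    using strict[of k] that unfolding N_def by blast
  then obtain y where y: "\<And>k. k < N \<Longrightarrow> y k \<in> I k" "\<And>k. k < N \<Longrightarrow> y k \<notin> I (Suc k)"
    by metis
  obtain d where d: "\<And>k. k < N \<Longrightarrow> exps_le d (y k)"
    using exists_exps_le[of N y] by blast
  \<comment> \<open>The exponents of monomials in \<open>y\<close> are bounded by \<open>N * D * d\<close>, and
    \<open>(N * D * d + 1) ^ n \<le> (N * d + 1) ^ n * (D + 1) ^ n\<close>; this choice of \<open>D\<close> makes
    the right-hand side smaller than \<open>(D + 1) ^ N\<close>, as \<open>N = n + 1\<close>.\<close>
  define D where "D = (N * d + 1) ^ CARD('n)"
  let ?f = "list_monomial y"
  have indep: "c l = 0" if "(\<Sum>l\<in>exponents D N. Const (c l) * ?f l) = 0" "l \<in> exponents D N" for c l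
  proof (rule prime_chain_independent[where N = N and k = N and I = I and y = y and D = D])
    show "(\<Sum>l\<in>exponents D N. Const (c l) * ?f l) \<in> I N"
      using that(1) prime_idealD(1)[OF prime[of N]] by (simp add: N_def)
  qed (use prime strict y that(2) in \<open>auto simp: N_def\<close>)
  have inj: "inj_on ?f (exponents D N)"
  proof (rule inj_onI, rule ccontr)
    fix l l' assume l: "l \<in> exponents D N" "l' \<in> exponents D N" "?f l = ?f l'" "l \<noteq> l'"
    define c :: "nat list \<Rightarrow> 'k" where "c = (\<lambda>q. if q = l then 1 else if q = l' then - 1 else 0)"
    have "(\<Sum>q\<in>exponents D N. Const (c q) * ?f q) = (\<Sum>q\<in>{l, l'}. Const (c q) * ?f q)"
      by (rule sum.mono_neutral_right) (use l in \<open>auto simp: c_def\<close>)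
    also have "\<dots> = 0"
      using l by (simp add: c_def Const_uminus)
    finally have "c l = 0" using indep l(1) by blast
    then show False by (simp add: c_def)
  qed
  have "mpoly_vs.independent (?f ` exponents D N)"
  proof (rule mpoly_vs.independent_if_scalars_zero)
    fix u x assume "(\<Sum>x\<in>?f ` exponents D N. Const (u x) * x) = 0" "x \<in> ?f ` exponents D N"
    then show "u x = 0"
      using indep[of "\<lambda>l. u (?f l)"] by (auto simp: sum.reindex[OF inj])
  qed simp
  moreover have "?f ` exponents D N \<subseteq> mpoly_vs.span (box_monomials (N * (D * d)))"
    using exps_le_list_monomial[of _ d y D] d
    by (auto simp: exponents_def intro!: exps_le_in_span)
  ultimately have "card (?f ` exponents D N)
      \<le> card (box_monomials (N * (D * d)) :: ('k, 'n) mpoly set)"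
    using mpoly_vs.independent_span_bound[OF finite_box_monomials] by blast
  then have "(D + 1) ^ N \<le> (N * (D * d) + 1) ^ CARD('n)"
    using card_box_monomials[of "N * (D * d)", where 'k = 'k and 'n = 'n]
    by (simp add: card_image[OF inj] card_exponents)
  also have "\<dots> \<le> ((N * d + 1) * (D + 1)) ^ CARD('n)"
    by (intro power_mono) (auto simp: algebra_simps)
  also have "\<dots> = D * (D + 1) ^ CARD('n)"
    unfolding power_mult_distrib by (simp add: D_def)
  also have "\<dots> < (D + 1) ^ N"
    by (simp add: N_def)
  finally show False by simp
qed

section \<open>Irreducible closed sets\<close>

lemma zariski_closed_iff:
  "zariski_closed X \<longleftrightarrow> X = {x. \<forall>P\<in>vanishing_ideal X. eval_mpoly P x = 0}"
proof
  assume "zariski_closed X"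
  then obtain S where S: "X = {x. \<forall>P\<in>S. eval_mpoly P x = 0}"
    by (auto simp: zariski_closed_def)
  then have "S \<subseteq> vanishing_ideal X"
    by (auto simp: vanishing_ideal_def)
  then show "X = {x. \<forall>P\<in>vanishing_ideal X. eval_mpoly P x = 0}"
    by (subst S) (auto simp: S vanishing_ideal_def)
qed (auto simp: zariski_closed_def)

lemma zariski_closedD:
  assumes "zariski_closed X" "\<forall>P\<in>vanishing_ideal X. eval_mpoly P x = 0"
  shows "x \<in> X"
  using assms(1)[unfolded zariski_closed_iff] assms(2) by blast

lemma zariski_closed_Int:
  assumes "zariski_closed X" "zariski_closed Y"
  shows "zariski_closed (X \<inter> Y)"
proof -
  from assms obtain S T where
    "X = {x. \<forall>P\<in>S. eval_mpoly P x = 0}" "Y = {x. \<forall>P\<in>T. eval_mpoly P x = 0}"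
    unfolding zariski_closed_def by auto
  then have "X \<inter> Y = {x. \<forall>P\<in>S \<union> T. eval_mpoly P x = 0}"
    by auto
  then show ?thesis
    unfolding zariski_closed_def by blast
qed

lemma zariski_closed_zero_set: "zariski_closed {x. eval_mpoly P x = 0}"
  unfolding zariski_closed_def by (intro exI[of _ "{P}"]) simp

lemma zariski_closed_common_zeros: "zariski_closed {x. \<forall>P\<in>S. eval_mpoly P x = 0}"
  unfolding zariski_closed_def by blast

lemma vanishing_ideal_antimono: "X \<subseteq> Y \<Longrightarrow> vanishing_ideal Y \<subseteq> vanishing_ideal X"
  by (auto simp: vanishing_ideal_def)

lemma vanishing_ideal_strict:
  assumes "zariski_closed X" "zariski_closed Y" "X \<subset> Y"
  shows "vanishing_ideal Y \<subset> vanishing_ideal X"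
  using assms vanishing_ideal_antimono[of X Y] zariski_closed_iff[of X] zariski_closed_iff[of Y]
  by blast

lemma irreducible_closedD:
  assumes "irreducible_closed X"
  shows "zariski_closed X" "X \<noteq> {}"
    "zariski_closed A \<Longrightarrow> zariski_closed B \<Longrightarrow> X = A \<union> B \<Longrightarrow> X = A \<or> X = B"
  using assms unfolding irreducible_closed_def by simp_all

lemma irreducible_subset_Un:
  assumes "irreducible_closed X" "zariski_closed A" "zariski_closed B" "X \<subseteq> A \<union> B"
  shows "X \<subseteq> A \<or> X \<subseteq> B"
proof -
  have "X = (X \<inter> A) \<union> (X \<inter> B)" using assms(4) by blast
  moreover have "zariski_closed (X \<inter> A)" "zariski_closed (X \<inter> B)"
    using irreducible_closedD(1)[OF assms(1)] assms(2,3) by (simp_all add: zariski_closed_Int)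
  ultimately have "X = X \<inter> A \<or> X = X \<inter> B"
    by (intro irreducible_closedD(3)[OF assms(1)])
  then show ?thesis by (metis inf.absorb_iff1)
qed

lemma prime_ideal_vanishing_ideal:
  fixes X :: "('k::field ^ 'n::finite) set"
  assumes "irreducible_closed X"
  shows "prime_ideal (vanishing_ideal X)"
proof -
  have "P \<in> vanishing_ideal X \<or> Q \<in> vanishing_ideal X" if "P * Q \<in> vanishing_ideal X" for P Q
  proof -
    have "X \<subseteq> {x. eval_mpoly P x = 0} \<union> {x. eval_mpoly Q x = 0}"
      using that by (auto simp: vanishing_ideal_def)
    from irreducible_subset_Un[OF assms zariski_closed_zero_set zariski_closed_zero_set this]
    show ?thesis by (auto simp: vanishing_ideal_def)
  qed
  moreover have "X \<noteq> {}"
    by (rule irreducible_closedD(2)[OF assms])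
  ultimately show ?thesis
    unfolding prime_ideal_def by (auto simp: vanishing_ideal_def)
qed

lemma irreducible_closed_singleton:
  fixes p :: "'k::comm_ring_1 ^ 'n::finite"
  shows "irreducible_closed {p}"
proof -
  have "{p} = {x. \<forall>P\<in>range (\<lambda>i. Var i - Const (p $ i)). eval_mpoly P x = 0}"
    by (auto simp: vec_eq_iff)
  then have "zariski_closed {p}"
    unfolding zariski_closed_def by blast
  then show ?thesis
    by (auto simp: irreducible_closed_def singleton_Un_iff)
qed

text \<open>
  Zorn's lemma, starting from a point of \<open>H\<close>: the closure of the union of a chain of irreducible
  closed sets is again irreducible, because if it were covered by two proper
  closed subsets, some member of the chain would not be contained in either of them.
\<close>

lemma exists_irreducible_component:
  fixes H :: "('k::field ^ 'n::finite) set"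
  assumes "zariski_closed H" "H \<noteq> {}"
  obtains Z where "Z \<in> irreducible_components H"
proof -
  define \<A> where "\<A> = {Z. irreducible_closed Z \<and> Z \<subseteq> H}"
  have "\<exists>U\<in>\<A>. \<forall>X\<in>C. X \<subseteq> U" if C: "subset.chain \<A> C" for C
  proof (cases "C = {}")
    case True
    obtain p where "p \<in> H" using assms(2) by blast
    then have "{p} \<in> \<A>" by (simp add: \<A>_def irreducible_closed_singleton)
    then show ?thesis using True by blast
  next
    case False
    have C_sub: "\<And>Z. Z \<in> C \<Longrightarrow> irreducible_closed Z \<and> Z \<subseteq> H"
      using C by (auto simp: subset.chain_def \<A>_def)
    define U where "U = {x. \<forall>P\<in>vanishing_ideal (\<Union>C). eval_mpoly P x = 0}"
    have closed: "zariski_closed U"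
      unfolding U_def by (rule zariski_closed_common_zeros)
    have UC: "\<Union>C \<subseteq> U"
      by (auto simp: U_def vanishing_ideal_def)
    have min: "U \<subseteq> A" if "zariski_closed A" "\<Union>C \<subseteq> A" for A
    proof -
      have "vanishing_ideal A \<subseteq> vanishing_ideal (\<Union>C)"
        using that(2) by (rule vanishing_ideal_antimono)
      then show ?thesis
        using that(1) unfolding zariski_closed_iff[of A] U_def by blast
    qed
    have "U = A \<or> U = B" if AB: "zariski_closed A" "zariski_closed B" "U = A \<union> B" for A B
    proof (rule ccontr)
      assume "\<not> ?thesis"
      then have "\<not> \<Union>C \<subseteq> A" "\<not> \<Union>C \<subseteq> B"
        using min AB by blast+
      then obtain X Y where XY: "X \<in> C" "Y \<in> C" "\<not> X \<subseteq> A" "\<not> Y \<subseteq> B"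
        by blast
      then have "X \<subseteq> Y \<or> Y \<subseteq> X"
        using C by (auto simp: subset.chain_def)
      then obtain Z where Z: "Z \<in> C" "\<not> Z \<subseteq> A" "\<not> Z \<subseteq> B"
        using XY by blast
      moreover have "Z \<subseteq> A \<union> B" using Z UC AB(3) by blast
      ultimately show False
        using irreducible_subset_Un[of Z A B] C_sub AB by blast
    qed
    moreover have "U \<noteq> {}"
      using UC False C_sub irreducible_closedD(2) by blast
    moreover have "U \<subseteq> H"
      using C_sub assms(1) by (intro min) auto
    ultimately have "U \<in> \<A>"
      using closed unfolding \<A>_def irreducible_closed_def by blast
    then show ?thesis using UC by blast
  qed
  then have "\<exists>M\<in>\<A>. \<forall>X\<in>\<A>. M \<subseteq> X \<longrightarrow> X = M"
    by (rule subset_Zorn)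
  then obtain M where "M \<in> \<A>" "\<And>X. X \<in> \<A> \<Longrightarrow> M \<subseteq> X \<Longrightarrow> X = M" by blast
  then have "M \<in> irreducible_components H"
    unfolding irreducible_components_def \<A>_def by blast
  then show ?thesis by (rule that)
qed

lemma irreducible_components_irreducible:
  "irreducible_closed Z \<Longrightarrow> irreducible_components Z = {Z}"
  unfolding irreducible_components_def by blast

text \<open>
  A finite supremum of natural numbers is attained unless it is the supremum \<open>0\<close> of the empty set,
  which is excluded here by the chain consisting of \<open>X\<close> alone.
\<close>

lemma krull_dim_chain:
  assumes "irreducible_closed X" "krull_dim X = enat d"
  obtains Z where "\<And>i. i \<le> d \<Longrightarrow> irreducible_closed (Z i)" "\<And>i. i \<le> d \<Longrightarrow> Z i \<subseteq> X"
    "\<And>i. i < d \<Longrightarrow> Z i \<subset> Z (Suc i)"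
proof -
  define L where "L e \<longleftrightarrow> (\<exists>Z. (\<forall>i\<le>e. irreducible_closed (Z i) \<and> Z i \<subseteq> X) \<and>
    (\<forall>i<e. Z i \<subset> Z (Suc i)))" for e :: nat
  have dim: "Sup {enat e | e. L e} = enat d"
    using assms(2) by (simp add: krull_dim_def L_def)
  have L0: "L 0"
    unfolding L_def by (rule exI[of _ "\<lambda>_. X"]) (use assms(1) in auto)
  have "L d"
  proof (rule ccontr)
    assume nL: "\<not> L d"
    then have "d \<noteq> 0" using L0 by metis
    have "x \<le> enat (d - 1)" if x: "x \<in> {enat e | e. L e}" for x
    proof -
      have "x \<le> enat d"
        using Sup_upper[OF x] dim by simp
      moreover have "x \<noteq> enat d" using x nL by auto
      moreover obtain e where "x = enat e" using x by auto
      ultimately show ?thesis by auto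
    qed
    then have "enat d \<le> enat (d - 1)"
      unfolding dim[symmetric] by (rule Sup_least)
    then show False using \<open>d \<noteq> 0\<close> by simp
  qed
  then show ?thesis
    using that unfolding L_def by blast
qed

text \<open>
  An element \<open>h\<close> of least degree in the prime ideal of \<open>Z\<close> is irreducible, hence prime. If it did not
  generate the ideal, the vanishing ideals of a chain of length \<open>n - 1\<close> inside \<open>Z\<close>, followed by the
  ideals \<open>(h)\<close> and \<open>0\<close>, would violate \<open>no_long_prime_chain\<close>.
\<close>

theorem vanishing_ideal_principal:
  fixes Z :: "('k::field ^ 'n::finite) set"
  assumes Z: "irreducible_closed Z" "krull_dim Z = enat (CARD('n) - 1)" "Z \<noteq> UNIV"
  obtains h where "h \<noteq> 0" "vanishing_ideal Z = {P. h dvd P}"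
proof -
  have prime: "prime_ideal (vanishing_ideal Z)"
    using Z(1) by (rule prime_ideal_vanishing_ideal)
  have "zariski_closed Z"
    by (rule irreducible_closedD(1)[OF Z(1)])
  then have "\<exists>P\<in>vanishing_ideal Z. eval_mpoly P x \<noteq> 0" if "x \<notin> Z" for x
    using that zariski_closedD by blast
  moreover obtain x where "x \<notin> Z"
    using Z(3) by blast
  ultimately obtain P0 where "P0 \<in> vanishing_ideal Z" "eval_mpoly P0 x \<noteq> 0" by blast
  then have "P0 \<in> vanishing_ideal Z \<and> P0 \<noteq> 0" by auto
  then obtain h where h: "h \<in> vanishing_ideal Z" "h \<noteq> 0"
    and least: "\<And>P. P \<in> vanishing_ideal Z \<Longrightarrow> P \<noteq> 0 \<Longrightarrow> degree_sum h \<le> degree_sum P"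
    using ex_has_least_nat[of "\<lambda>P. P \<in> vanishing_ideal Z \<and> P \<noteq> 0" P0 degree_sum] by blast
  have not_unit: "\<not> h dvd 1"
    using prime_ideal_dvd[OF prime h(1)] prime_idealD(4)[OF prime] by blast
  have "irreducible h"
  proof (rule irreducibleI)
    fix a b assume ab: "h = a * b"
    then have nz: "a \<noteq> 0" "b \<noteq> 0" using h by auto
    have unit: "P dvd 1" if "P \<noteq> 0" "degree_sum P = 0" for P :: "('k, 'n) mpoly"
      using that by (auto simp: unit_iff_Const degree_sum_eq_0_iff)
    have "a \<in> vanishing_ideal Z \<or> b \<in> vanishing_ideal Z"
      using h(1) ab prime_idealD(5)[OF prime] by blast
    then show "a dvd 1 \<or> b dvd 1"
      using least[of a] least[of b] unit[of a] unit[of b] nz ab by (auto simp: degree_sum_mult)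
  qed (use h not_unit in auto)
  then have prime_h: "prime_elem h"
    by (rule irreducible_imp_prime_elem_mpoly)
  have "h dvd q" if q: "q \<in> vanishing_ideal Z" for q
  proof (rule ccontr)
    assume nq: "\<not> h dvd q"
    define n where "n = CARD('n)"
    have n: "n \<ge> 1" by (simp add: n_def Suc_leI)
    obtain C where C: "\<And>i. i \<le> n - 1 \<Longrightarrow> irreducible_closed (C i)"
      "\<And>i. i \<le> n - 1 \<Longrightarrow> C i \<subseteq> Z" "\<And>i. i < n - 1 \<Longrightarrow> C i \<subset> C (Suc i)"
      using krull_dim_chain[OF Z(1,2)] unfolding n_def by blast
    \<comment> \<open>The last member of the chain may be smaller than \<open>Z\<close>; its ideal still contains \<open>q\<close>,
      so the inclusion of \<open>(h)\<close> in it is strict.\<close>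
    define I where "I k = (if k \<le> n - 1 then vanishing_ideal (C k)
      else if k = n then {P. h dvd P} else {0})" for k
    have I: "k \<le> n - 1 \<Longrightarrow> I k = vanishing_ideal (C k)" "I n = {P. h dvd P}" "I (Suc n) = {0}" for k
      using n by (auto simp: I_def)
    have cases: "k \<le> n - 1 \<or> k = n \<or> k = Suc n" if "k \<le> n + 1" for k
      using that by auto
    have "prime_ideal (I k)" if "k \<le> n + 1" for k
    proof -
      have "prime_ideal {P. h dvd P}"
        using prime_h by (auto simp: prime_ideal_def prime_elem_def)
      moreover have "prime_ideal {0 :: ('k, 'n) mpoly}"
        by (auto simp: prime_ideal_def mpoly_mult_eq_0_iff)
      ultimately show ?thesis
        using cases[OF that] I C(1) prime_ideal_vanishing_ideal by metis
    qed
    moreover have "I (Suc k) \<subset> I k" if k: "k < n + 1" for k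
    proof -
      consider "k < n - 1" | "k = n - 1" | "k = n"
        using k n by linarith
      then show ?thesis
      proof cases
        case 1
        then show ?thesis
          using vanishing_ideal_strict[OF _ _ C(3)[OF 1]] C(1)[of k] C(1)[of "Suc k"]
          by (simp add: I irreducible_closedD(1))
      next
        case 2
        then have "Suc k = n" using n by simp
        moreover have "vanishing_ideal Z \<subseteq> vanishing_ideal (C k)"
          using C(2)[of k] 2 by (intro vanishing_ideal_antimono) auto
        moreover have "{P. h dvd P} \<subseteq> vanishing_ideal Z"
          using prime_ideal_dvd[OF prime h(1)] by blast
        ultimately show ?thesis
          using I(1)[of k] I(2) 2 nq q by auto
      next
        case 3
        then show ?thesis
          using I(2,3) h(2) by auto
      qed
    qed
    ultimately show False
      using no_long_prime_chain[of I] unfolding n_def by blast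
  qed
  moreover have "P \<in> vanishing_ideal Z" if "h dvd P" for P
    using prime_ideal_dvd[OF prime h(1) that] .
  ultimately have "vanishing_ideal Z = {P. h dvd P}" by blast
  with h(2) show ?thesis by (rule that)
qed

section \<open>Fixed hypersurfaces\<close>

text \<open>
  Let $h$ generate the vanishing ideal and write $f_i = x_i + h a_i$, and let $c$ be the Jacobian of
  $f$. On $Z$ the rank one determinant gives $\sum_i a_i \partial_i h = c - 1$, and comparing
  derivatives turns $h \circ f = u h$ with a unit $u$ into $h \circ f = c h$. The statements on the
  gradient and on the fixed points both come down to $c \neq 1$.
\<close>

lemma fixed_hypersurface:
  fixes f :: "('k::alg_closed_field, 'n::finite) mpoly ^ 'n"
  assumes f: "poly_automorphism f" "\<not> special f"
    and Z: "irreducible_closed Z" "krull_dim Z = enat (CARD('n) - 1)" "Z \<subseteq> Fix f"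
  obtains h where "vanishing_ideal Z = {P. h dvd P}"
    and "\<And>p. p \<in> Z \<Longrightarrow> \<exists>i. eval_mpoly (partial_deriv i h) p \<noteq> 0"
    and "Fix f \<subseteq> Z"
proof -
  obtain g where gf: "\<And>x. poly_map g (poly_map f x) = x"
    using f(1) by (auto simp: poly_automorphism_def)
  have fix_f: "poly_map f x = x" if "x \<in> Z" for x
    using that Z(3) by (auto simp: Fix_def)
  have fix_g: "poly_map g x = x" if "x \<in> Z" for x
    using gf[of x] fix_f[OF that] by simp
  have closed: "zariski_closed Z" and "Z \<noteq> {}"
    by (rule irreducible_closedD[OF Z(1)])+
  \<comment> \<open>Otherwise \<open>f\<close> is the identity, which is special.\<close>
  have "Z \<noteq> UNIV"
  proof
    assume "Z = UNIV"
    have "f $ i = Var i" for i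
    proof (rule eval_eqI[OF infinite_UNIV_alg_closed])
      fix x
      have "poly_map f x $ i = x $ i" using fix_f[of x] \<open>Z = UNIV\<close> by simp
      then show "eval_mpoly (f $ i) x = eval_mpoly (Var i) x"
        by (simp add: poly_map_def)
    qed
    then have "Jac f = det (mat 1 :: ('k, 'n) mpoly ^ 'n ^ 'n)"
      unfolding Jac_def by (intro arg_cong[where f = det])
        (simp add: partial_deriv_Var mat_def vec_eq_iff)
    then show False using f(2) by (simp add: special_def)
  qed
  then obtain h where h: "h \<noteq> 0" "vanishing_ideal Z = {P. h dvd P}"
    using vanishing_ideal_principal[OF Z(1,2)] by blast
  have h_zero: "eval_mpoly h p = 0" if "p \<in> Z" for p
    using h(2) that by (auto simp: vanishing_ideal_def)
  have in_ideal: "h dvd P" if "\<And>p. p \<in> Z \<Longrightarrow> eval_mpoly P p = 0" for P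
    using h(2) that by (auto simp: vanishing_ideal_def)
  obtain c where c: "Jac f = Const c"
    using Jac_automorphism[OF f(1)] by blast
  then have "c \<noteq> 1" using f(2) by (auto simp: special_def)
  have "\<exists>a. f $ i = Var i + h * a" for i
  proof -
    have "h dvd f $ i - Var i"
    proof (rule in_ideal)
      fix p assume "p \<in> Z"
      then have "poly_map f p $ i = p $ i" by (simp add: fix_f)
      then show "eval_mpoly (f $ i - Var i) p = 0" by (simp add: poly_map_def)
    qed
    then obtain a where "f $ i - Var i = h * a" ..
    then show ?thesis by (auto simp: algebra_simps)
  qed
  then have "\<forall>i. \<exists>a. f $ i = Var i + h * a" by blast
  then obtain a where a: "\<And>i. f $ i = Var i + h * a i"
    using choice[of "\<lambda>i a. f $ i = Var i + h * a"] by blast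
  define A where "A p = (\<chi> i. eval_mpoly (a i) p)" for p
  define B where "B p = (\<chi> i. eval_mpoly (partial_deriv i h) p)" for p
  have df: "eval_mpoly (partial_deriv j (f $ i)) p = (if j = i then 1 else 0) + A p $ i * B p $ j"
    if "p \<in> Z" for i j p
    using that by (simp add: a partial_deriv_add partial_deriv_mult partial_deriv_Var h_zero
        A_def B_def mult.commute)
  have trace: "1 + (\<Sum>i\<in>UNIV. A p $ i * B p $ i) = c" if "p \<in> Z" for p
  proof -
    have "c = eval_mpoly (Jac f) p" by (simp add: c)
    also have "\<dots> = det (\<chi> i. axis i 1 + A p $ i *s B p)"
      unfolding Jac_def eval_det
      by (rule arg_cong[where f = det]) (auto simp: df[OF that] vec_eq_iff axis_def)
    also have "\<dots> = 1 + (\<Sum>i\<in>UNIV. A p $ i * B p $ i)"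
      by (rule det_identity_plus_rank_one)
    finally show ?thesis ..
  qed
  have gradient: "\<exists>i. B p $ i \<noteq> 0" if "p \<in> Z" for p
  proof (rule ccontr)
    assume "\<not> ?thesis"
    then show False using trace[OF that] \<open>c \<noteq> 1\<close> by simp
  qed
  obtain u where u: "compose_mpoly f h = h * u"
    using in_ideal[of "compose_mpoly f h"] by (auto simp: eval_compose_mpoly fix_f h_zero)
  obtain v where v: "compose_mpoly g h = h * v"
    using in_ideal[of "compose_mpoly g h"] by (auto simp: eval_compose_mpoly fix_g h_zero)
  \<comment> \<open>Expand \<open>h = (h \<circ> g) \<circ> f\<close>.\<close>
  have "h * (u * compose_mpoly f v) = h * 1"
  proof (rule eval_eqI[OF infinite_UNIV_alg_closed])
    fix x
    have "eval_mpoly h x = eval_mpoly (compose_mpoly g h) (poly_map f x)"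
      by (simp add: eval_compose_mpoly gf)
    also have "\<dots> = eval_mpoly (compose_mpoly f h) x * eval_mpoly v (poly_map f x)"
      by (simp add: v eval_compose_mpoly)
    finally show "eval_mpoly (h * (u * compose_mpoly f v)) x = eval_mpoly (h * 1) x"
      by (simp add: u eval_compose_mpoly mult.assoc)
  qed
  then have "u * compose_mpoly f v = 1"
    by (rule mpoly_mult_left_cancel[OF h(1)])
  then have "u dvd 1" by (metis dvd_triv_left)
  then obtain u0 where u0: "u = Const u0"
    by (auto simp: unit_iff_Const)
  obtain p where p: "p \<in> Z" using \<open>Z \<noteq> {}\<close> by blast
  obtain j where j: "B p $ j \<noteq> 0" using gradient[OF p] by blast
  \<comment> \<open>Compute the derivative of \<open>h \<circ> f = u0 * h\<close> at a point of \<open>Z\<close> in two ways.\<close>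
  have "B p $ j * u0 = eval_mpoly (partial_deriv j (compose_mpoly f h)) p"
    by (simp add: u u0 partial_deriv_mult B_def)
  also have "\<dots> = (\<Sum>i\<in>UNIV. B p $ i * ((if j = i then 1 else 0) + A p $ i * B p $ j))"
    by (simp add: partial_deriv_compose eval_sum eval_compose_mpoly fix_f[OF p] df[OF p] B_def)
  also have "\<dots> = (\<Sum>i\<in>UNIV. if j = i then B p $ i else 0) + (\<Sum>i\<in>UNIV. B p $ j * (A p $ i * B p $ i))"
    by (subst sum.distrib[symmetric], rule sum.cong) (auto simp: algebra_simps)
  also have "\<dots> = B p $ j * (1 + (\<Sum>i\<in>UNIV. A p $ i * B p $ i))"
    by (simp add: sum_distrib_left distrib_left)
  also have "\<dots> = B p $ j * c"
    by (simp add: trace[OF p])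
  finally have "u0 = c" using j by simp
  have "Fix f \<subseteq> Z"
  proof
    fix x assume "x \<in> Fix f"
    then have "eval_mpoly h x = eval_mpoly (compose_mpoly f h) x"
      by (simp add: Fix_def eval_compose_mpoly)
    then have "eval_mpoly h x * (1 - c) = 0"
      by (simp add: u u0 \<open>u0 = c\<close> algebra_simps)
    then have "eval_mpoly h x = 0"
      using \<open>c \<noteq> 1\<close> by simp
    then have "\<forall>P\<in>vanishing_ideal Z. eval_mpoly P x = 0"
      by (auto simp: h(2))
    then show "x \<in> Z"
      by (rule zariski_closedD[OF closed])
  qed
  moreover have "\<exists>i. eval_mpoly (partial_deriv i h) p \<noteq> 0" if "p \<in> Z" for p
    using gradient[OF that] by (simp add: B_def)
  ultimately show ?thesis
    by (intro that[OF h(2)])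
qed

text \<open>
  The kernel together with one vector on which the functional takes the value 1 spans everything.
\<close>

lemma dim_kernel_functional:
  fixes b :: "'k::field ^ 'n::finite"
  assumes "b $ i \<noteq> 0"
  shows "vec.dim {v. (\<Sum>j\<in>UNIV. b $ j * v $ j) = 0} = CARD('n) - 1"
proof -
  let ?b = "\<lambda>v :: 'k ^ 'n. \<Sum>j\<in>UNIV. b $ j * v $ j"
  let ?W = "{v. ?b v = 0}"
  define w where "w = (axis i (inverse (b $ i)) :: 'k ^ 'n)"
  have b_add: "?b (u + v) = ?b u + ?b v" and b_scale: "?b (r *s v) = r * ?b v" for u v r
    by (simp_all add: sum.distrib[symmetric] sum_distrib_left algebra_simps)
  have "?b w = (\<Sum>j\<in>UNIV. if i = j then b $ j * inverse (b $ i) else 0)"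
    by (rule sum.cong) (auto simp: w_def axis_def)
  then have w: "?b w = 1"
    using assms by simp
  have sub: "vec.subspace ?W"
    by (rule vec.subspaceI) (auto simp only: mem_Collect_eq b_add b_scale, simp_all)
  then have "w \<notin> vec.span ?W"
    using w by (simp add: vec.span_eq_iff[THEN iffD2])
  moreover have "vec.span (insert w ?W) = UNIV"
  proof -
    have "v \<in> vec.span (insert w ?W)" for v
    proof -
      have "?b (v - ?b v *s w) = 0"
        using b_add[of "v - ?b v *s w" "?b v *s w"] b_scale[of "?b v" w] w by simp
      then have "v - ?b v *s w \<in> vec.span (insert w ?W)"
        by (intro vec.span_base) simp
      moreover have "?b v *s w \<in> vec.span (insert w ?W)"
        by (intro vec.span_scale vec.span_base) simp
      ultimately show ?thesis
        using vec.span_add by fastforce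
    qed
    then show ?thesis by blast
  qed
  then have "vec.dim (insert w ?W) = CARD('n)"
    by (metis vec.dim_span vec.dim_UNIV vec.dimension_def vec_dim_card)
  ultimately show ?thesis
    by (simp add: vec.dim_insert)
qed

theorem theorem1p1:
  fixes f :: "('k::alg_closed_field, 'n::finite) mpoly ^ 'n"
    and H :: "('k ^ 'n) set"
  assumes "poly_automorphism f"
    and "\<not> special f"
    and "hypersurface H"
    and "H \<subseteq> Fix f"
  shows "(smooth H \<and> irreducible_closed H) \<and> H = Fix f"
proof -
  from assms(3) have "zariski_closed H" "H \<noteq> {}"
    by (auto simp: hypersurface_def)
  then obtain Z where Z: "Z \<in> irreducible_components H"
    by (rule exists_irreducible_component)
  then have irr: "irreducible_closed Z" and sub: "Z \<subseteq> H"
    by (auto simp: irreducible_components_def)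
  have dim: "krull_dim Z = enat (CARD('n) - 1)"
    using assms(3) Z by (auto simp: hypersurface_def)
  obtain h where h: "vanishing_ideal Z = {P. h dvd P}"
    and gradient: "\<And>p. p \<in> Z \<Longrightarrow> \<exists>i. eval_mpoly (partial_deriv i h) p \<noteq> 0"
    and "Fix f \<subseteq> Z"
    using fixed_hypersurface[OF assms(1,2) irr dim] sub assms(4) by blast
  then have H: "H = Z" "H = Fix f"
    using sub assms(4) by auto
  have "smooth Z"
    unfolding smooth_def
  proof
    fix p assume p: "p \<in> Z"
    then have h_zero: "eval_mpoly h p = 0"
      using h by (auto simp: vanishing_ideal_def)
    let ?b = "\<chi> i. eval_mpoly (partial_deriv i h) p"
    \<comment> \<open>The differential of \<open>h * Q\<close> at a zero of \<open>h\<close> is a multiple of the differential of \<open>h\<close>.\<close>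
    have "(\<forall>P\<in>vanishing_ideal Z. (\<Sum>i\<in>UNIV. eval_mpoly (partial_deriv i P) p * v $ i) = 0)
        \<longleftrightarrow> (\<Sum>i\<in>UNIV. ?b $ i * v $ i) = 0" for v
    proof
      assume "(\<Sum>i\<in>UNIV. ?b $ i * v $ i) = 0"
      moreover have "(\<Sum>i\<in>UNIV. eval_mpoly (partial_deriv i (h * Q)) p * v $ i)
          = eval_mpoly Q p * (\<Sum>i\<in>UNIV. ?b $ i * v $ i)" for Q
        by (simp add: partial_deriv_mult h_zero sum_distrib_left mult_ac)
      ultimately show "\<forall>P\<in>vanishing_ideal Z. (\<Sum>i\<in>UNIV. eval_mpoly (partial_deriv i P) p * v $ i) = 0"
        by (auto simp: h elim!: dvdE)
    qed (auto simp: h)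
    then have "tangent_space Z p = {v. (\<Sum>i\<in>UNIV. ?b $ i * v $ i) = 0}"
      by (simp add: tangent_space_def)
    moreover obtain i where "?b $ i \<noteq> 0"
      using gradient[OF p] by auto
    ultimately have "vec.dim (tangent_space Z p) = CARD('n) - 1"
      using dim_kernel_functional[of ?b i] by simp
    moreover have "{Y \<in> irreducible_components Z. p \<in> Y} = {Z}"
      using irreducible_components_irreducible[OF irr] p by auto
    then have "local_dim Z p = enat (CARD('n) - 1)"
      by (simp add: local_dim_def dim)
    ultimately show "enat (vec.dim (tangent_space Z p)) = local_dim Z p"
      by simp
  qed
  then show ?thesis
    using H irr by simp
qed

end
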